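(* Let $W$ be a Weyl tensor of type I$_r$, with eigenvalues $\rho_1,\rho_2,\rho_3$ and orthonormal frame $\{\mathcal U_i\}$ of self-dual eigenbivectors, so that $\mathcal W=-\sum_{i}\rho_i\,\mathcal U_i\otimes\mathcal U_i$. Then its Bel-Robinson tensor $T$ admits the canonical expression $$T=\sum_{i=1}^3t_i\,\Pi_i\otimes\Pi_i+\sum_{(ijk)}\tau_i\,\Pi_{jk}\otimes\Pi_{jk}+\sum_{(ijk)}\overline{\tau}_i\,\Pi_{kj}\otimes\Pi_{kj},$$ where $\sum_{(ijk)}$ runs over the even permutations of $(1,2,3)$, $t_i=|\rho_i|^2$, $\tau_i=\rho_j\overline\rho_k$, $\Pi_i=\mathcal U_i\cdot\overline{\mathcal U}_i$, $\Pi_{jk}=\mathcal U_j\cdot\overline{\mathcal U}_k$. All nine eigenvalues $t_i,\tau_i,\overline\tau_i$ are different, and $\{\Pi_i,\Pi_{jk},\Pi_{kj}\}$ is (up to ordering and signs) the sole normalized frame of eigentensors of $T$.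
   Context: $(V,g)$ is an oriented 4-dimensional real vector space with a Lorentzian metric of signature $(-,+,+,+)$ (the tangent space of a space-time at a point); indices are moved with $g$; $\eta$ is the metric volume element; $( *F)_{\alpha\beta}=\frac12\eta_{\alpha\beta\mu\nu}F^{\mu\nu}$, $( *W)_{\alpha\beta\mu\nu}=\frac12\eta_{\alpha\beta}{}^{\rho\sigma}W_{\rho\sigma\mu\nu}$. A self-dual (SD) bivector is a complex 2-form $\mathcal F$ with $*\mathcal F=\mathrm i\mathcal F$; these form a complex 3-dimensional space with metric $\mathcal G(\mathcal F,\mathcal H)=\frac12\mathcal F_{\alpha\beta}\mathcal H^{\alpha\beta}$. A frame $\{\mathcal U_i\}$ of SD bivectors is orthonormal if $\mathcal G(\mathcal U_i,\mathcal U_j)=-\delta_{ij}$. A Weyl tensor $W$ is a real 4-tensor with the algebraic symmetries of a Riemann tensor and vanishing traces; $\mathcal W=\frac12(W-\mathrm i*W)$ acts on SD bivectors by $\mathcal W(\mathcal F)_{\alpha\beta}=\frac12\mathcal W_{\alpha\beta}{}^{\mu\nu}\mathcal F_{\mu\nu}$, with eigenvalues $\rho_i$, $\sum\rho_i=0$. Put $a=\operatorname{Tr}\mathcal W^2=\sum\rho_i^2$, $b=\operatorname{Tr}\mathcal W^3=\sum\rho_i^3$, $M=a^3/b^2-6$. $W$ is of type I if the $\rho_i$ are distinct (equivalently $6b^2\ne a^3$), and of type I$_r$ if it is of type I, $b\neq 0$ and $M$ is not real. The Bel-Robinson (BR) tensor of $W$ is $T_{\alpha\mu\beta\nu}=\mathcal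 W_{\alpha}{}^{\rho}{}_{\beta}{}^{\sigma}\,\overline{\mathcal W}_{\mu\rho\nu\sigma}$; it is totally symmetric and traceless and acts on the (complexified) 9-dimensional space of traceless symmetric 2-tensors by $T(A)_{\alpha\beta}=T_{\alpha\beta}{}^{\mu\nu}A_{\mu\nu}$; an eigentensor is an eigenvector of this map. Normalized means $(A,A)=A_{\alpha\beta}A^{\alpha\beta}=1$ (complex bilinear). For 2-tensors $(A\cdot B)_{\alpha\beta}=A_{\alpha}{}^{\mu}B_{\mu\beta}$. *)

theory Defs
  imports "HOL-Analysis.Analysis"
begin

text \<open>
  Tensors on a 4-dimensional real vector space \<open>V\<close> are given by their covariant components in an
  arbitrary (not necessarily orthonormal) basis of \<open>V\<close>, indexed by the type \<open>4\<close>. The metric is an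
  arbitrary symmetric matrix \<open>g\<close> of signature \<open>(-,+,+,+)\<close>, and the orientation of \<open>V\<close> is the sign
  \<open>orient\<close>, equal to \<open>1\<close> or \<open>-1\<close> according to whether the basis is positively oriented or not.
\<close>

type_synonym rtensor4 = "real^4^4^4^4"
type_synonym tensor2 = "complex^4^4"
type_synonym tensor4 = "complex^4^4^4^4"

section \<open>Two-tensors as a complex vector space\<close>

text \<open>The library only equips nested vectors with real scalar multiplication.\<close>

definition cscale :: "complex \<Rightarrow> tensor2 \<Rightarrow> tensor2" (infixr "*\<^sub>C" 75) where
  "c *\<^sub>C A = (\<chi> \<alpha> \<beta>. c * A $ \<alpha> $ \<beta>)"

interpretation ctensor: vector_space cscale
  by unfold_locales (simp_all add: cscale_def vec_eq_iff algebra_simps)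

definition frame_of :: "tensor2 set \<Rightarrow> ('n \<Rightarrow> tensor2) \<Rightarrow> bool" where
  "frame_of S B \<longleftrightarrow> inj B \<and> ctensor.independent (range B) \<and> ctensor.span (range B) = S"

definition cnj_tensor :: "tensor2 \<Rightarrow> tensor2" where
  "cnj_tensor A = (\<chi> \<alpha> \<beta>. cnj (A $ \<alpha> $ \<beta>))"

section \<open>Metric and volume element\<close>

definition lorentzian :: "real^4^4 \<Rightarrow> bool" where
  "lorentzian g \<longleftrightarrow> transpose g = g \<and>
     (\<exists>P :: real^4^4. invertible P \<and>
        transpose P ** g ** P = (\<chi> \<alpha> \<beta>. if \<alpha> = \<beta> then (if \<alpha> = 1 then - 1 else 1) else 0))"

definition ginv :: "real^4^4 \<Rightarrow> 4 \<Rightarrow> 4 \<Rightarrow> complex" where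
  "ginv g \<alpha> \<beta> = complex_of_real (matrix_inv g $ \<alpha> $ \<beta>)"

definition raise :: "real^4^4 \<Rightarrow> tensor2 \<Rightarrow> tensor2" where
  "raise g A = (\<chi> \<alpha> \<beta>. \<Sum>\<mu>\<in>UNIV. \<Sum>\<nu>\<in>UNIV. ginv g \<alpha> \<mu> * ginv g \<beta> \<nu> * A $ \<mu> $ \<nu>)"

text \<open>The determinant below is the Levi-Civita symbol with \<open>\<epsilon>\<^sub>1\<^sub>2\<^sub>3\<^sub>4 = 1\<close>.\<close>

definition volume :: "real^4^4 \<Rightarrow> real \<Rightarrow> 4 \<Rightarrow> 4 \<Rightarrow> 4 \<Rightarrow> 4 \<Rightarrow> real" where
  "volume g orient \<alpha> \<beta> \<mu> \<nu> = orient * sqrt \<bar>det g\<bar> *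
     det (vector [axis \<alpha> 1, axis \<beta> 1, axis \<mu> 1, axis \<nu> 1] :: real^4^4)"

definition inner2 :: "real^4^4 \<Rightarrow> tensor2 \<Rightarrow> tensor2 \<Rightarrow> complex" where
  "inner2 g A B = (\<Sum>\<alpha>\<in>UNIV. \<Sum>\<beta>\<in>UNIV. A $ \<alpha> $ \<beta> * raise g B $ \<alpha> $ \<beta>)"

text \<open>\<open>(A \<cdot> B)\<^sub>\<alpha>\<^sub>\<beta> = A\<^sub>\<alpha>\<^sup>\<mu> B\<^sub>\<mu>\<^sub>\<beta>\<close>\<close>

definition dot2 :: "real^4^4 \<Rightarrow> tensor2 \<Rightarrow> tensor2 \<Rightarrow> tensor2" where
  "dot2 g A B = (\<chi> \<alpha> \<beta>. \<Sum>\<mu>\<in>UNIV. \<Sum>\<nu>\<in>UNIV. A $ \<alpha> $ \<nu> * ginv g \<nu> \<mu> * B $ \<mu> $ \<beta>)"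

text \<open>\<open>S\<^sub>\<alpha>\<^sub>\<beta>\<^sup>\<mu>\<^sup>\<nu> A\<^sub>\<mu>\<^sub>\<nu>\<close>\<close>

definition contract :: "real^4^4 \<Rightarrow> tensor4 \<Rightarrow> tensor2 \<Rightarrow> tensor2" where
  "contract g S A = (\<chi> \<alpha> \<beta>. \<Sum>\<mu>\<in>UNIV. \<Sum>\<nu>\<in>UNIV. S $ \<alpha> $ \<beta> $ \<mu> $ \<nu> * raise g A $ \<mu> $ \<nu>)"

section \<open>Self-dual bivectors\<close>

definition hodge :: "real^4^4 \<Rightarrow> real \<Rightarrow> tensor2 \<Rightarrow> tensor2" where
  "hodge g orient F = (\<chi> \<alpha> \<beta>. (1/2) *
     (\<Sum>\<mu>\<in>UNIV. \<Sum>\<nu>\<in>UNIV. complex_of_real (volume g orient \<alpha> \<beta> \<mu> \<nu>) * raise g F $ \<mu> $ \<nu>))"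

definition sd_bivectors :: "real^4^4 \<Rightarrow> real \<Rightarrow> tensor2 set" where
  "sd_bivectors g orient = {F. transpose F = - F \<and> hodge g orient F = \<i> *\<^sub>C F}"

definition sd_metric :: "real^4^4 \<Rightarrow> tensor2 \<Rightarrow> tensor2 \<Rightarrow> complex" where
  "sd_metric g F H = (1/2) * inner2 g F H"

definition orthonormal_sd_frame :: "real^4^4 \<Rightarrow> real \<Rightarrow> (3 \<Rightarrow> tensor2) \<Rightarrow> bool" where
  "orthonormal_sd_frame g orient U \<longleftrightarrow> frame_of (sd_bivectors g orient) U \<and>
     (\<forall>i j. sd_metric g (U i) (U j) = (if i = j then - 1 else 0))"

section \<open>Weyl tensors\<close>

definition weyl_tensor :: "real^4^4 \<Rightarrow> rtensor4 \<Rightarrow> bool" where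
  "weyl_tensor g W \<longleftrightarrow>
     (\<forall>\<alpha> \<beta> \<mu> \<nu>. W $ \<alpha> $ \<beta> $ \<mu> $ \<nu> = - W $ \<beta> $ \<alpha> $ \<mu> $ \<nu> \<and>
                W $ \<alpha> $ \<beta> $ \<mu> $ \<nu> = - W $ \<alpha> $ \<beta> $ \<nu> $ \<mu> \<and>
                W $ \<alpha> $ \<beta> $ \<mu> $ \<nu> = W $ \<mu> $ \<nu> $ \<alpha> $ \<beta> \<and>
                W $ \<alpha> $ \<beta> $ \<mu> $ \<nu> + W $ \<alpha> $ \<mu> $ \<nu> $ \<beta> + W $ \<alpha> $ \<nu> $ \<beta> $ \<mu> = 0) \<and>
     (\<forall>\<beta> \<nu>. (\<Sum>\<alpha>\<in>UNIV. \<Sum>\<mu>\<in>UNIV. matrix_inv g $ \<alpha> $ \<mu> * W $ \<alpha> $ \<beta> $ \<mu> $ \<nu>) = 0)"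

definition complexify :: "rtensor4 \<Rightarrow> tensor4" where
  "complexify W = (\<chi> \<alpha> \<beta> \<mu> \<nu>. complex_of_real (W $ \<alpha> $ \<beta> $ \<mu> $ \<nu>))"

text \<open>Dual on the first pair of indices: \<open>(*W)\<^sub>\<alpha>\<^sub>\<beta>\<^sub>\<mu>\<^sub>\<nu> = 1/2 \<eta>\<^sub>\<alpha>\<^sub>\<beta>\<^sup>\<rho>\<^sup>\<sigma> W\<^sub>\<rho>\<^sub>\<sigma>\<^sub>\<mu>\<^sub>\<nu>\<close>.\<close>

definition hodge4 :: "real^4^4 \<Rightarrow> real \<Rightarrow> tensor4 \<Rightarrow> tensor4" where
  "hodge4 g orient W = (\<chi> \<alpha> \<beta> \<mu> \<nu>. hodge g orient (\<chi> \<rho> \<sigma>. W $ \<rho> $ \<sigma> $ \<mu> $ \<nu>) $ \<alpha> $ \<beta>)"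

definition sd_weyl :: "real^4^4 \<Rightarrow> real \<Rightarrow> rtensor4 \<Rightarrow> tensor4" where
  "sd_weyl g orient W = (\<chi> \<alpha> \<beta> \<mu> \<nu>. (1/2) *
     (complexify W $ \<alpha> $ \<beta> $ \<mu> $ \<nu> - \<i> * hodge4 g orient (complexify W) $ \<alpha> $ \<beta> $ \<mu> $ \<nu>))"

definition bivector_map :: "real^4^4 \<Rightarrow> tensor4 \<Rightarrow> tensor2 \<Rightarrow> tensor2" where
  "bivector_map g S F = (1/2) *\<^sub>C contract g S F"

text \<open>
  Composition and trace of endomorphisms of the space of bivectors, written with index pairs running
  over all (ordered) pairs, hence the factors 1/2. For a self-dual Weyl tensor this trace is the trace
  over self-dual bivectors, since the tensor annihilates the anti-self-dual ones.
\<close>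

definition bivector_comp :: "real^4^4 \<Rightarrow> tensor4 \<Rightarrow> tensor4 \<Rightarrow> tensor4" where
  "bivector_comp g R S =
     (\<chi> \<alpha> \<beta> \<mu> \<nu>. bivector_map g R (\<chi> \<rho> \<sigma>. S $ \<rho> $ \<sigma> $ \<mu> $ \<nu>) $ \<alpha> $ \<beta>)"

definition bivector_trace :: "real^4^4 \<Rightarrow> tensor4 \<Rightarrow> complex" where
  "bivector_trace g S = (1/2) * (\<Sum>\<alpha>\<in>UNIV. \<Sum>\<beta>\<in>UNIV. \<Sum>\<mu>\<in>UNIV. \<Sum>\<nu>\<in>UNIV.
     ginv g \<alpha> \<mu> * ginv g \<beta> \<nu> * S $ \<alpha> $ \<beta> $ \<mu> $ \<nu>)"

definition weyl_a :: "real^4^4 \<Rightarrow> real \<Rightarrow> rtensor4 \<Rightarrow> complex" where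
  "weyl_a g orient W = (let S = sd_weyl g orient W in bivector_trace g (bivector_comp g S S))"

definition weyl_b :: "real^4^4 \<Rightarrow> real \<Rightarrow> rtensor4 \<Rightarrow> complex" where
  "weyl_b g orient W = (let S = sd_weyl g orient W in
     bivector_trace g (bivector_comp g S (bivector_comp g S S)))"

definition weyl_M :: "real^4^4 \<Rightarrow> real \<Rightarrow> rtensor4 \<Rightarrow> complex" where
  "weyl_M g orient W = weyl_a g orient W ^ 3 / weyl_b g orient W ^ 2 - 6"

text \<open>The space of self-dual bivectors has dimension 3, so three distinct eigenvalues are all of them.\<close>

definition type_I :: "real^4^4 \<Rightarrow> real \<Rightarrow> rtensor4 \<Rightarrow> bool" where
  "type_I g orient W \<longleftrightarrow> (\<exists>\<rho>::3 \<Rightarrow> complex. inj \<rho> \<and>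
     (\<forall>i. \<exists>F \<in> sd_bivectors g orient. F \<noteq> 0 \<and>
        bivector_map g (sd_weyl g orient W) F = \<rho> i *\<^sub>C F))"

definition type_Ir :: "real^4^4 \<Rightarrow> real \<Rightarrow> rtensor4 \<Rightarrow> bool" where
  "type_Ir g orient W \<longleftrightarrow>
     type_I g orient W \<and> weyl_b g orient W \<noteq> 0 \<and> weyl_M g orient W \<notin> \<real>"

section \<open>The Bel-Robinson tensor and its eigentensors\<close>

text \<open>\<open>T\<^sub>\<alpha>\<^sub>\<mu>\<^sub>\<beta>\<^sub>\<nu>\<close>, with the second index of \<open>T\<close> being the first one of the conjugate factor.\<close>

definition bel_robinson :: "real^4^4 \<Rightarrow> real \<Rightarrow> rtensor4 \<Rightarrow> tensor4" where
  "bel_robinson g orient W = (let S = sd_weyl g orient W in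
     (\<chi> \<alpha> \<mu> \<beta> \<nu>. \<Sum>\<rho>\<in>UNIV. \<Sum>\<rho>'\<in>UNIV. \<Sum>\<sigma>\<in>UNIV. \<Sum>\<sigma>'\<in>UNIV.
        ginv g \<rho> \<rho>' * ginv g \<sigma> \<sigma>' * S $ \<alpha> $ \<rho>' $ \<beta> $ \<sigma>' * cnj (S $ \<mu> $ \<rho> $ \<nu> $ \<sigma>)))"

definition traceless_symmetric :: "real^4^4 \<Rightarrow> tensor2 set" where
  "traceless_symmetric g =
     {A. transpose A = A \<and> (\<Sum>\<alpha>\<in>UNIV. \<Sum>\<beta>\<in>UNIV. ginv g \<alpha> \<beta> * A $ \<alpha> $ \<beta>) = 0}"

definition eigentensor :: "real^4^4 \<Rightarrow> tensor4 \<Rightarrow> complex \<Rightarrow> tensor2 \<Rightarrow> bool" where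
  "eigentensor g T c A \<longleftrightarrow> A \<in> traceless_symmetric g \<and> A \<noteq> 0 \<and> contract g T A = c *\<^sub>C A"

definition normalized_eigenframe :: "real^4^4 \<Rightarrow> tensor4 \<Rightarrow> ('n \<Rightarrow> tensor2) \<Rightarrow> bool" where
  "normalized_eigenframe g T B \<longleftrightarrow> frame_of (traceless_symmetric g) B \<and>
     (\<forall>n. inner2 g (B n) (B n) = 1 \<and> (\<exists>c. eigentensor g T c (B n)))"

definition Pi_tensor :: "real^4^4 \<Rightarrow> (3 \<Rightarrow> tensor2) \<Rightarrow> 3 \<Rightarrow> 3 \<Rightarrow> tensor2" where
  "Pi_tensor g U i j = dot2 g (U i) (cnj_tensor (U j))"

definition t_val :: "(3 \<Rightarrow> complex) \<Rightarrow> 3 \<Rightarrow> complex" where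
  "t_val \<rho> i = complex_of_real ((cmod (\<rho> i))\<^sup>2)"

text \<open>
  Addition on the type \<open>3\<close> is modulo 3, so the even permutations \<open>(i,j,k)\<close> of \<open>(1,2,3)\<close> are exactly
  \<open>(i, i + 1, i + 2)\<close> for the three values of \<open>i\<close>.
\<close>

definition tau_val :: "(3 \<Rightarrow> complex) \<Rightarrow> 3 \<Rightarrow> complex" where
  "tau_val \<rho> i = \<rho> (i + 1) * cnj (\<rho> (i + 2))"

end

theory Submission imports Defs begin

text \<open>
  For antisymmetric contravariant \<open>X\<close>, \<open>Y\<close> with Levi-Civita duals \<open>X'\<close>, \<open>Y'\<close>, the matrix
  \<open>X Y' + Y X'\<close> is a multiple of the identity; no metric enters. Applied to bivectors that are
  eigenvectors of the Hodge operator, this yields all the algebra that is needed: with one index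
  raised, the \<open>U i\<close> satisfy the Clifford relations \<open>U i U j + U j U i = \<delta> i j\<close>, so do their
  conjugates, and the two families commute. Hence the metric, the \<open>U i\<close>, their conjugates and the
  products \<open>\<Pi> i j\<close> are sixteen trace-orthogonal matrices, that is, a basis of all two-tensors, in
  which the antisymmetric and the traceless symmetric tensors are the obvious subspaces.

  Expanding \<open>W\<close> in this basis, vanishing of the traces together with the pair symmetry removes the
  mixed self-dual/anti-self-dual part and makes \<open>\<rho> 1 + \<rho> 2 + \<rho> 3\<close> purely imaginary; the first Bianchi
  identity makes it real, hence zero. The Bel-Robinson tensor is then diagonal in the \<open>\<Pi> i j\<close> with
  eigenvalues \<open>\<rho> i * cnj (\<rho> j)\<close>. A coincidence among these would force \<open>\<bar>\<rho> i\<bar> = \<bar>\<rho> j\<bar>\<close> or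
  \<open>\<rho> i * cnj (\<rho> j)\<close> real for some \<open>i \<noteq> j\<close>, and either one makes \<open>a\<^sup>3 / b\<^sup>2\<close> real.
\<close>

section \<open>Matrices\<close>

text \<open>Expansion along the first row; it evaluates the Levi-Civita symbol on explicit
  indices.\<close>

lemma det_4: "det (A::'a::comm_ring_1^4^4) =
   A$1$1 * (A$2$2*A$3$3*A$4$4 + A$2$3*A$3$4*A$4$2 + A$2$4*A$3$2*A$4$3
          - A$2$2*A$3$4*A$4$3 - A$2$3*A$3$2*A$4$4 - A$2$4*A$3$3*A$4$2)
 - A$1$2 * (A$2$1*A$3$3*A$4$4 + A$2$3*A$3$4*A$4$1 + A$2$4*A$3$1*A$4$3
          - A$2$1*A$3$4*A$4$3 - A$2$3*A$3$1*A$4$4 - A$2$4*A$3$3*A$4$1)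
 + A$1$3 * (A$2$1*A$3$2*A$4$4 + A$2$2*A$3$4*A$4$1 + A$2$4*A$3$1*A$4$2
          - A$2$1*A$3$4*A$4$2 - A$2$2*A$3$1*A$4$4 - A$2$4*A$3$2*A$4$1)
 - A$1$4 * (A$2$1*A$3$2*A$4$3 + A$2$2*A$3$3*A$4$1 + A$2$3*A$3$1*A$4$2
          - A$2$1*A$3$3*A$4$2 - A$2$2*A$3$1*A$4$3 - A$2$3*A$3$2*A$4$1)"
proof -
  have f234: "finite {2::4, 3, 4}" "1 \<notin> {2::4, 3, 4}" by auto
  have f34: "finite {3::4, 4}" "2 \<notin> {3::4, 4}" by auto
  have f4: "finite {4::4}" "3 \<notin> {4::4}" by auto
  show ?thesis
    unfolding det_def UNIV_4
    unfolding sum_over_permutations_insert[OF f234]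
    unfolding sum_over_permutations_insert[OF f34]
    unfolding sum_over_permutations_insert[OF f4]
    unfolding permutes_sing
    by (simp add: sign_swap_id permutation_swap_id sign_compose sign_id permutation_compose algebra_simps)
qed

lemma cscale_nth [simp]: "(c *\<^sub>C A) $ \<alpha> $ \<beta> = c * A $ \<alpha> $ \<beta>"
  by (simp add: cscale_def)

lemma cscale_mult_left: "(c *\<^sub>C A) ** B = c *\<^sub>C (A ** B)"
  and cscale_mult_right: "A ** (c *\<^sub>C B) = c *\<^sub>C (A ** B)"
  by (simp_all add: vec_eq_iff matrix_matrix_mult_def sum_distrib_left mult_ac)

lemma mat_mult: "mat c ** A = c *\<^sub>C A" and mult_mat: "A ** mat c = c *\<^sub>C A"
  by (simp_all add: vec_eq_iff matrix_matrix_mult_def mat_def if_distrib if_distribR mult.commute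
      cong: if_cong)

lemma trace_cscale: "trace (c *\<^sub>C A) = c * trace A"
  by (simp add: trace_def sum_distrib_left)

lemma trace_mat: "trace (mat c :: complex^4^4) = 4 * c"
  by (simp add: trace_def mat_def)

lemma trace_uminus: "trace (- A :: complex^'n^'n) = - trace A"
  by (simp add: trace_def sum_negf)

lemma trace_transpose: "trace (transpose A) = trace (A :: complex^'n^'n)"
  by (simp add: trace_def transpose_def)

lemma trace_mult_transpose:
  "trace (A ** transpose B) = (\<Sum>\<alpha>\<in>UNIV. \<Sum>\<beta>\<in>UNIV. A $ \<alpha> $ \<beta> * B $ \<alpha> $ \<beta>)"
  by (simp add: trace_def matrix_matrix_mult_def transpose_def)

lemma trace_sum: "trace (\<Sum>i\<in>I. f i :: complex^'n^'n) = (\<Sum>i\<in>I. trace (f i))"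
  by (induction I rule: infinite_finite_induct) (auto simp: trace_add trace_0[unfolded mat_0])

lemma matrix_mult_uminus_left: "(- A) ** B = - (A ** B)"
  and matrix_mult_uminus_right: "A ** (- B) = - (A ** B)"
  for A B :: "complex^'n^'n"
  by (simp_all add: vec_eq_iff matrix_matrix_mult_def sum_negf)

lemma transpose_cscale: "transpose (c *\<^sub>C A) = c *\<^sub>C transpose A"
  by (simp add: vec_eq_iff transpose_def)

lemma matrix_add_rdistrib: "(A + B) ** C = A ** C + B ** C"
  for A B C :: "complex^'n^'n"
  by (simp add: vec_eq_iff matrix_matrix_mult_def algebra_simps sum.distrib)

lemma matrix_diff_ldistrib: "A ** (B - C) = A ** B - A ** C" for A B C :: "complex^'n^'n"
  by (simp add: vec_eq_iff matrix_matrix_mult_def algebra_simps sum_subtractf)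

lemma sum_matrix_mult: "(\<Sum>i\<in>I. f i) ** B = (\<Sum>i\<in>I. f i ** B)"
  and matrix_mult_sum_right: "B ** (\<Sum>i\<in>I. f i) = (\<Sum>i\<in>I. B ** f i)"
  for f :: "'i \<Rightarrow> complex^'n^'n"
  by (induction I rule: infinite_finite_induct)
    (auto simp: matrix_add_rdistrib matrix_add_ldistrib)

lemma cnj_tensor_nth [simp]: "cnj_tensor A $ \<alpha> $ \<beta> = cnj (A $ \<alpha> $ \<beta>)"
  by (simp add: cnj_tensor_def)

lemma cnj_tensor_mult: "cnj_tensor (A ** B) = cnj_tensor A ** cnj_tensor B"
  by (simp add: vec_eq_iff matrix_matrix_mult_def)

lemma cnj_tensor_add: "cnj_tensor (A + B) = cnj_tensor A + cnj_tensor B"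
  and cnj_tensor_uminus: "cnj_tensor (- A) = - cnj_tensor A"
  and cnj_tensor_cscale: "cnj_tensor (c *\<^sub>C A) = cnj c *\<^sub>C cnj_tensor A"
  and cnj_tensor_mat: "cnj_tensor (mat c) = mat (cnj c)"
  and cnj_tensor_transpose: "cnj_tensor (transpose A) = transpose (cnj_tensor A)"
  and cnj_tensor_cnj [simp]: "cnj_tensor (cnj_tensor A) = A"
  by (simp_all add: vec_eq_iff transpose_def mat_def)

lemma trace_cnj_tensor: "trace (cnj_tensor A) = cnj (trace A)"
  by (simp add: trace_def)

section \<open>Trace-orthonormal families and Clifford triples\<close>

text \<open>A dual basis for the trace form is a left inverse, hence also a right inverse.\<close>

lemma dual_family_complete:
  fixes f h :: "'a::finite \<Rightarrow> 'b::finite \<Rightarrow> complex"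
  assumes "CARD('a) = CARD('b)"
    and orth: "\<And>a c. (\<Sum>b\<in>UNIV. f a b * h c b) = (if a = c then 1 else 0)"
  shows "(\<Sum>a\<in>UNIV. h a b * f a d) = (if b = d then 1 else 0)"
proof -
  \<comment> \<open>Reindexing along a bijection makes both families square matrices over one index
    type, where a one-sided inverse is two-sided.\<close>
  obtain e :: "'b \<Rightarrow> 'a" where e: "bij e"
    using finite_same_card_bij[of "UNIV :: 'b set" "UNIV :: 'a set"] assms(1) by auto
  define M :: "complex^'b^'b" where "M = (\<chi> r c. f (e r) c)"
  define N :: "complex^'b^'b" where "N = (\<chi> c r. h (e r) c)"
  have "M ** N = mat 1"
    using e by (simp add: vec_eq_iff M_def N_def matrix_matrix_mult_def mat_def orth bij_def inj_eq)
  then have "N ** M = mat 1"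
    by (simp add: matrix_left_right_inverse)
  then have "(N ** M) $ b $ d = mat 1 $ b $ d" by simp
  then have "(\<Sum>r\<in>UNIV. h (e r) b * f (e r) d) = (if b = d then 1 else 0)"
    by (simp add: M_def N_def matrix_matrix_mult_def mat_def)
  then show ?thesis
    using sum.reindex_bij_betw[OF e, of "\<lambda>a. h a b * f a d"] by simp
qed

text \<open>Sixteen trace-orthonormal matrices fill the 16-dimensional matrix space, so they satisfy
  a Fierz completeness identity; contracting it with \<open>X\<close> gives the expansion.\<close>

lemma trace_orthonormal_expansion:
  fixes \<Gamma> :: "'i::finite \<Rightarrow> tensor2"
  assumes "CARD('i) = 16"
    and orth: "\<And>a b. trace (\<Gamma> a ** \<Gamma> b) = (if a = b then 1 else 0)"
  shows "X = (\<Sum>a\<in>UNIV. trace (X ** \<Gamma> a) *\<^sub>C \<Gamma> a)"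
proof -
  have sp: "(\<Sum>p\<in>UNIV. k (fst p) (snd p)) = (\<Sum>\<alpha>\<in>UNIV. \<Sum>\<beta>\<in>UNIV. k \<alpha> \<beta>)" for k :: "4 \<Rightarrow> 4 \<Rightarrow> complex"
    by (simp add: sum.cartesian_product case_prod_unfold)
  have "CARD('i) = CARD(4 \<times> 4)" using assms(1) by simp
  moreover have "(\<Sum>p\<in>UNIV. \<Gamma> a $ fst p $ snd p * \<Gamma> b $ snd p $ fst p) = (if a = b then 1 else 0)" for a b
    using orth[of a b] sp[of "\<lambda>\<alpha> \<beta>. \<Gamma> a $ \<alpha> $ \<beta> * \<Gamma> b $ \<beta> $ \<alpha>"]
    by (simp add: trace_def matrix_matrix_mult_def)
  \<comment> \<open>The first factor has its indices exchanged because the trace form pairs entry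
    (\<open>\<alpha>\<close>, \<open>\<beta>\<close>) with entry (\<open>\<beta>\<close>,
    \<open>\<alpha>\<close>).\<close>
  ultimately have fierz: "(\<Sum>a\<in>UNIV. \<Gamma> a $ snd p $ fst p * \<Gamma> a $ fst q $ snd q) = (if p = q then 1 else 0)" for p q
    by (rule dual_family_complete)
  have "(\<Sum>a\<in>UNIV. trace (X ** \<Gamma> a) * \<Gamma> a $ \<alpha> $ \<beta>) = X $ \<alpha> $ \<beta>" for \<alpha> \<beta>
  proof -
    have "(\<Sum>a\<in>UNIV. trace (X ** \<Gamma> a) * \<Gamma> a $ \<alpha> $ \<beta>) =
      (\<Sum>a\<in>UNIV. \<Sum>p\<in>UNIV. X $ fst p $ snd p * (\<Gamma> a $ snd p $ fst p * \<Gamma> a $ \<alpha> $ \<beta>))"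
      using sp[of "\<lambda>\<gamma> \<delta>. X $ \<gamma> $ \<delta> * (\<Gamma> _ $ \<delta> $ \<gamma> * \<Gamma> _ $ \<alpha> $ \<beta>)"]
      by (simp add: trace_def matrix_matrix_mult_def sum_distrib_right mult.assoc)
    also have "\<dots> = (\<Sum>p\<in>UNIV. X $ fst p $ snd p * (if p = (\<alpha>, \<beta>) then 1 else 0))"
      using fierz[of _ "(\<alpha>, \<beta>)"] by (subst sum.swap) (simp flip: sum_distrib_left)
    finally show ?thesis by (simp add: if_distrib cong: if_cong)
  qed
  then show ?thesis by (simp add: vec_eq_iff)
qed

text \<open>The anticommutator is normalized to 1 instead of 2, the value that bivectors of norm -1
  produce; hence the generators square to 1/2.\<close>

definition clifford_triple :: "(3 \<Rightarrow> tensor2) \<Rightarrow> bool" where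
  "clifford_triple u \<longleftrightarrow> (\<forall>i j. u i ** u j + u j ** u i = mat (if i = j then 1 else 0))"

lemma clifford_square: "u i ** u i = mat (1/2)" if "clifford_triple u"
proof -
  have "u i ** u i + u i ** u i = mat 1"
    using that by (simp add: clifford_triple_def)
  moreover have "A = mat (1/2)" if "A + A = mat 1" for A :: tensor2
  proof -
    have "A = (1/2) *\<^sub>C (A + A)" by (simp add: vec_eq_iff)
    also have "\<dots> = mat (1/2)" unfolding that by (simp add: vec_eq_iff mat_def)
    finally show ?thesis .
  qed
  ultimately show ?thesis by blast
qed

lemma clifford_anticommute: "u i ** u j = - (u j ** u i)" if "clifford_triple u" "i \<noteq> j"
proof -
  have "u i ** u j + u j ** u i = mat 0"
    using that unfolding clifford_triple_def by metis
  then show ?thesis by (simp add: eq_neg_iff_add_eq_0 add.commute)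
qed

text \<open>\<open>u j\<close> commutes or anticommutes with \<open>u i\<close>; moving it across
  leaves the factor 1/2 from its square.\<close>

lemma clifford_sandwich:
  assumes "clifford_triple u"
  shows "u j ** u i ** u j = (if i = j then 1/2 else - 1/2) *\<^sub>C u i"
proof (cases "i = j")
  case True
  then show ?thesis by (simp add: clifford_square[OF assms] mat_mult)
next
  case False
  then have "u j ** u i ** u j = - (u i ** (u j ** u j))"
    using clifford_anticommute[OF assms, of j i]
    by (simp add: matrix_mult_uminus_left matrix_mul_assoc)
  then show ?thesis
    using False by (simp add: clifford_square[OF assms] mult_mat vec_eq_iff)
qed

lemma ex_other: "\<exists>m::3. m \<noteq> i"
  by (rule exI[of _ "i + 1"]) simp

text \<open>Conjugating with another generator flips the sign of \<open>u i\<close>, but not the trace.\<close>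

lemma clifford_trace_single:
  assumes u: "clifford_triple u" and Z: "\<And>j. u j ** Z = Z ** u j"
  shows "trace (u i ** Z) = 0"
proof -
  obtain m :: 3 where m: "m \<noteq> i" using ex_other by blast
  have "trace (u m ** u i ** u m ** Z) = trace (u m ** u i ** Z ** u m)"
    by (metis Z matrix_mul_assoc)
  also have "\<dots> = trace (u m ** u m ** u i ** Z)"
    by (metis trace_mul_sym matrix_mul_assoc)
  also have "\<dots> = 1/2 * trace (u i ** Z)"
    by (simp add: clifford_square[OF u] mat_mult cscale_mult_left trace_cscale)
  finally show ?thesis
    using m by (simp add: clifford_sandwich[OF u] cscale_mult_left trace_cscale
        matrix_mult_uminus_left trace_uminus)
qed

text \<open>Anticommuting the two generators flips the sign, while cyclicity of the trace, with
  \<open>Z\<close> commuting past, restores their order without a sign.\<close>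

lemma clifford_trace_pair:
  assumes u: "clifford_triple u" and Z: "\<And>j. u j ** Z = Z ** u j" and "i \<noteq> k"
  shows "trace (u i ** u k ** Z) = 0"
proof -
  have "trace (u i ** u k ** Z) = - trace (u k ** u i ** Z)"
    using clifford_anticommute[OF u \<open>i \<noteq> k\<close>] by (simp add: matrix_mult_uminus_left trace_uminus)
  also have "trace (u k ** u i ** Z) = trace (u k ** Z ** u i)"
    by (metis Z matrix_mul_assoc)
  also have "\<dots> = trace (u i ** u k ** Z)"
    by (metis trace_mul_sym matrix_mul_assoc)
  finally show ?thesis by simp
qed

text \<open>Each \<open>u i\<close> squares to \<open>1/2\<close>; scaling the unit accordingly makes all products
  trace-orthonormal.\<close>

definition adjoin_unit :: "(3 \<Rightarrow> tensor2) \<Rightarrow> 3 option \<Rightarrow> tensor2" where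
  "adjoin_unit u a = (case a of None \<Rightarrow> mat (complex_of_real (1 / sqrt 2)) | Some i \<Rightarrow> u i)"

lemma adjoin_unit_simps [simp]:
  "adjoin_unit u None = mat (complex_of_real (1 / sqrt 2))" "adjoin_unit u (Some i) = u i"
  by (simp_all add: adjoin_unit_def)

lemma adjoin_unit_square: "adjoin_unit u a ** adjoin_unit u a = mat (1/2)" if "clifford_triple u"
proof (cases a)
  case None
  have "complex_of_real (1 / sqrt 2) * complex_of_real (1 / sqrt 2) = complex_of_real (1/2)"
    by (simp flip: of_real_mult)
  then have "r * r = 1/2 \<Longrightarrow> mat r ** mat r = (mat (1/2) :: tensor2)" for r :: complex
    by (simp add: mat_mult) (simp add: vec_eq_iff mat_def)
  from this[of "complex_of_real (1 / sqrt 2)"] show ?thesis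
    using None by (simp flip: of_real_mult)
qed (simp add: clifford_square[OF that])

lemma adjoin_unit_trace:
  assumes u: "clifford_triple u" and Z: "\<And>j. u j ** Z = Z ** u j" and "a \<noteq> b"
  shows "trace (adjoin_unit u a ** adjoin_unit u b ** Z) = 0"
  using \<open>a \<noteq> b\<close> clifford_trace_single[OF u Z] clifford_trace_pair[OF u Z]
  by (cases a; cases b) (auto simp: mat_mult mult_mat cscale_mult_left trace_cscale)

text \<open>The commuting families can be regrouped into a \<open>u\<close> part times a
  \<open>v\<close> part. Different \<open>u\<close> factors kill the trace with the \<open>v\<close>
  part as spectator; equal ones give 1/2, and the same dichotomy for \<open>v\<close> leaves 1/2 *
  1/2 * 4 = 1.\<close>

lemma clifford_product_orthonormal:
  assumes u: "clifford_triple u" and v: "clifford_triple v"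
    and comm: "\<And>i j. u i ** v j = v j ** u i"
  shows "trace (adjoin_unit u a ** adjoin_unit v b ** (adjoin_unit u c ** adjoin_unit v d)) =
    (if (a, b) = (c, d) then 1 else 0)"
proof -
  have comm': "u i ** adjoin_unit v b = adjoin_unit v b ** u i" for i b
    by (cases b) (auto simp: comm mat_mult mult_mat)
  have comm'': "adjoin_unit v b ** adjoin_unit u c = adjoin_unit u c ** adjoin_unit v b"
    by (cases c) (auto simp: comm' mat_mult mult_mat)
  let ?Z = "adjoin_unit v b ** adjoin_unit v d"
  have eq: "adjoin_unit u a ** adjoin_unit v b ** (adjoin_unit u c ** adjoin_unit v d) =
    adjoin_unit u a ** adjoin_unit u c ** ?Z"
    by (metis comm'' matrix_mul_assoc)
  have Z: "u j ** ?Z = ?Z ** u j" for j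
    by (metis comm' matrix_mul_assoc)
  show ?thesis
  proof (cases "a = c")
    case False
    then show ?thesis unfolding eq using adjoin_unit_trace[OF u Z] by simp
  next
    case True
    then have "trace (adjoin_unit u a ** adjoin_unit u c ** ?Z) = 1/2 * trace ?Z"
      by (simp add: adjoin_unit_square[OF u] mat_mult trace_cscale)
    also have "\<dots> = (if b = d then 1 else 0)"
      using adjoin_unit_trace[OF v, of "mat 1" b d]
      by (simp add: adjoin_unit_square[OF v] trace_mat)
    finally show ?thesis using True eq by simp
  qed
qed

text \<open>The sixteen products are sorted by how many factors are the adjoined unit
  \<open>mat r\<close>. Each unit enters twice, in the coefficient and in the basis element, which
  yields \<open>r * r\<close> = 1/2 per unit: the weights 1/4, 1/2 and 1.\<close>

lemma clifford_expansion:
  assumes u: "clifford_triple u" and v: "clifford_triple v"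
    and comm: "\<And>i j. u i ** v j = v j ** u i"
  shows "X = (trace X / 4) *\<^sub>C mat 1
    + (1/2) *\<^sub>C (\<Sum>i\<in>UNIV. trace (X ** u i) *\<^sub>C u i)
    + (1/2) *\<^sub>C (\<Sum>j\<in>UNIV. trace (X ** v j) *\<^sub>C v j)
    + (\<Sum>i\<in>UNIV. \<Sum>j\<in>UNIV. trace (X ** (u i ** v j)) *\<^sub>C (u i ** v j))"
proof -
  define r where "r = complex_of_real (1 / sqrt 2)"
  have r: "r * r = 1/2" by (simp add: r_def flip: of_real_mult)
  have r': "r * (r * x) = x / 2" for x using r by (simp flip: mult.assoc)
  have rr: "r * x * r = x / 2" for x using r' by (simp add: ac_simps)
  have N: "adjoin_unit w None = mat r" for w by (simp add: r_def)
  have NN: "trace (X ** (mat r ** mat r)) *\<^sub>C (mat r ** mat r) = (trace X / 4) *\<^sub>C mat 1"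
  proof -
    have "mat r ** mat r = (mat (1/2) :: tensor2)"
      using r by (simp add: mat_mult) (simp add: vec_eq_iff mat_def)
    then show ?thesis by (simp add: mult_mat trace_cscale) (simp add: vec_eq_iff mat_def)
  qed
  let ?\<Gamma> = "\<lambda>(a, b). adjoin_unit u a ** adjoin_unit v b"
  have so: "(\<Sum>a\<in>UNIV. k a) = k None + (\<Sum>i\<in>UNIV. k (Some i))" for k :: "3 option \<Rightarrow> tensor2"
    by (simp add: UNIV_option_conv sum.reindex)
  have "X = (\<Sum>a\<in>UNIV. trace (X ** ?\<Gamma> a) *\<^sub>C ?\<Gamma> a)"
    by (rule trace_orthonormal_expansion)
      (simp_all add: clifford_product_orthonormal[OF u v comm] case_prod_unfold prod_eq_iff)
  also have "\<dots> = (\<Sum>a\<in>UNIV. \<Sum>b\<in>UNIV. trace (X ** (adjoin_unit u a ** adjoin_unit v b)) *\<^sub>C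
      (adjoin_unit u a ** adjoin_unit v b))"
    by (simp add: sum.cartesian_product case_prod_unfold)
  also have "\<dots> = (trace X / 4) *\<^sub>C mat 1
    + (1/2) *\<^sub>C (\<Sum>i\<in>UNIV. trace (X ** u i) *\<^sub>C u i)
    + (1/2) *\<^sub>C (\<Sum>j\<in>UNIV. trace (X ** v j) *\<^sub>C v j)
    + (\<Sum>i\<in>UNIV. \<Sum>j\<in>UNIV. trace (X ** (u i ** v j)) *\<^sub>C (u i ** v j))"
    by (simp add: so N NN del: adjoin_unit_simps(1))
      (simp add: mat_mult mult_mat cscale_mult_right trace_cscale rr sum.distrib
        ctensor.scale_sum_right add_ac)
  finally show ?thesis .
qed

section \<open>The Levi-Civita and Hodge duals\<close>

text \<open>As a matrix, the inverse metric turns index contractions into matrix products: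
  \<open>A ** inverse_metric g\<close> is \<open>A\<close> with its second index raised.\<close>

definition inverse_metric :: "real^4^4 \<Rightarrow> tensor2" where
  "inverse_metric g = (\<chi> \<alpha> \<beta>. ginv g \<alpha> \<beta>)"

lemma ginv_nth: "ginv g \<alpha> \<beta> = inverse_metric g $ \<alpha> $ \<beta>"
  by (simp add: inverse_metric_def)

lemma dot2_eq: "dot2 g A B = A ** inverse_metric g ** B"
  by (simp add: vec_eq_iff dot2_def matrix_matrix_mult_def ginv_nth sum_distrib_right)

lemma raise_eq: "raise g A = inverse_metric g ** A ** transpose (inverse_metric g)"
  unfolding raise_def vec_eq_iff matrix_matrix_mult_def ginv_nth transpose_def
  by (subst sum.swap) (simp add: sum_distrib_left mult_ac)

lemma inner2_eq_trace:
  "inner2 g A B = trace (A ** transpose (raise g B))"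
  by (simp add: inner2_def trace_def matrix_matrix_mult_def transpose_def)

lemma raise_scale: "raise g (c *\<^sub>C A) = c *\<^sub>C raise g A"
  and raise_add: "raise g (A + B) = raise g A + raise g B"
  by (simp_all add: raise_eq cscale_mult_left cscale_mult_right matrix_add_rdistrib matrix_add_ldistrib)

lemma hodge_scale: "hodge g o' (c *\<^sub>C A) = c *\<^sub>C hodge g o' A"
  and hodge_add: "hodge g o' (A + B) = hodge g o' A + hodge g o' B"
  by (simp_all add: vec_eq_iff hodge_def raise_scale raise_add distrib_left sum.distrib
      sum_distrib_left mult_ac)

lemma hodge_sum: "hodge g o' (\<Sum>i\<in>I. f i) = (\<Sum>i\<in>I. hodge g o' (f i))"
proof (induction I rule: infinite_finite_induct)
  case (insert x F)
  then show ?case by (simp add: hodge_add)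
qed (use hodge_scale[of g o' 0 0] in simp_all)

section \<open>The metric-free dual of a bivector\<close>

definition levi_civita :: "4 \<Rightarrow> 4 \<Rightarrow> 4 \<Rightarrow> 4 \<Rightarrow> real" where
  "levi_civita \<alpha> \<beta> \<mu> \<nu> = det (vector [axis \<alpha> 1, axis \<beta> 1, axis \<mu> 1, axis \<nu> 1] :: real^4^4)"

definition dual :: "tensor2 \<Rightarrow> tensor2" where
  "dual X = (\<chi> \<alpha> \<beta>. (1/2) * (\<Sum>\<mu>\<in>UNIV. \<Sum>\<nu>\<in>UNIV.
     complex_of_real (levi_civita \<alpha> \<beta> \<mu> \<nu>) * X $ \<mu> $ \<nu>))"

lemma vector_4_nth:
  "(vector [x,y,z,w] :: 'a::zero^4) $ 1 = x"
  "(vector [x,y,z,w] :: 'a::zero^4) $ 2 = y"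
  "(vector [x,y,z,w] :: 'a::zero^4) $ 3 = z"
  "(vector [x,y,z,w] :: 'a::zero^4) $ 4 = w"
  by (simp_all add: vector_def)

lemma levi_civita_perm:
  "levi_civita 1 2 3 4 = 1"
  "levi_civita 1 2 4 3 = - 1"
  "levi_civita 1 3 2 4 = - 1"
  "levi_civita 1 3 4 2 = 1"
  "levi_civita 1 4 2 3 = 1"
  "levi_civita 1 4 3 2 = - 1"
  "levi_civita 2 1 3 4 = - 1"
  "levi_civita 2 1 4 3 = 1"
  "levi_civita 2 3 1 4 = 1"
  "levi_civita 2 3 4 1 = - 1"
  "levi_civita 2 4 1 3 = - 1"
  "levi_civita 2 4 3 1 = 1"
  "levi_civita 3 1 2 4 = 1"
  "levi_civita 3 1 4 2 = - 1"
  "levi_civita 3 2 1 4 = - 1"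
  "levi_civita 3 2 4 1 = 1"
  "levi_civita 3 4 1 2 = 1"
  "levi_civita 3 4 2 1 = - 1"
  "levi_civita 4 1 2 3 = - 1"
  "levi_civita 4 1 3 2 = 1"
  "levi_civita 4 2 1 3 = 1"
  "levi_civita 4 2 3 1 = - 1"
  "levi_civita 4 3 1 2 = - 1"
  "levi_civita 4 3 2 1 = 1"
  by (simp_all add: levi_civita_def det_4 vector_4_nth axis_def)

lemma levi_civita_repeat:
  "levi_civita \<alpha> \<alpha> \<mu> \<nu> = 0" "levi_civita \<alpha> \<mu> \<alpha> \<nu> = 0" "levi_civita \<alpha> \<mu> \<nu> \<alpha> = 0"
  "levi_civita \<mu> \<alpha> \<alpha> \<nu> = 0" "levi_civita \<mu> \<alpha> \<nu> \<alpha> = 0" "levi_civita \<mu> \<nu> \<alpha> \<alpha> = 0"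
  unfolding levi_civita_def
  by (simp_all add: det_4 vector_4_nth algebra_simps)

lemma antisymmetric_nth: "A $ \<alpha> $ \<beta> = - A $ \<beta> $ \<alpha>" if "transpose A = - A" for A :: "complex^'n^'n"
  using arg_cong[OF that, of "\<lambda>B. B $ \<beta> $ \<alpha>"] by (simp add: transpose_def)

text \<open>Duality exchanges complementary index pairs up to sign, so products with duals become
  polynomials in the six independent entries.\<close>

lemma dual_nth:
  assumes "transpose X = - X"
  shows "dual X $ 1 $ 1 = 0" "dual X $ 1 $ 2 = X $ 3 $ 4" "dual X $ 1 $ 3 = - X $ 2 $ 4"
    "dual X $ 1 $ 4 = X $ 2 $ 3" "dual X $ 2 $ 1 = - X $ 3 $ 4" "dual X $ 2 $ 2 = 0"
    "dual X $ 2 $ 3 = X $ 1 $ 4" "dual X $ 2 $ 4 = - X $ 1 $ 3" "dual X $ 3 $ 1 = X $ 2 $ 4"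
    "dual X $ 3 $ 2 = - X $ 1 $ 4" "dual X $ 3 $ 3 = 0" "dual X $ 3 $ 4 = X $ 1 $ 2"
    "dual X $ 4 $ 1 = - X $ 2 $ 3" "dual X $ 4 $ 2 = X $ 1 $ 3" "dual X $ 4 $ 3 = - X $ 1 $ 2"
    "dual X $ 4 $ 4 = 0"
  by (simp_all add: dual_def sum_4 levi_civita_perm levi_civita_repeat antisymmetric_nth[OF assms, of 2 1]
      antisymmetric_nth[OF assms, of 3 1] antisymmetric_nth[OF assms, of 4 1] antisymmetric_nth[OF assms, of 3 2]
      antisymmetric_nth[OF assms, of 4 2] antisymmetric_nth[OF assms, of 4 3])

text \<open>Polarization of \<open>X * dual X = - Pf(X)\<close>.\<close>

lemma mult_dual_anticommute:
  assumes "transpose X = - X" "transpose Y = - Y"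
  obtains c where "X ** dual Y + Y ** dual X = mat c"
proof
  have a: "X $ \<mu> $ \<nu> = - X $ \<nu> $ \<mu>" "Y $ \<mu> $ \<nu> = - Y $ \<nu> $ \<mu>" for \<mu> \<nu>
    by (rule antisymmetric_nth[OF assms(1)], rule antisymmetric_nth[OF assms(2)])
  have d: "X $ \<mu> $ \<mu> = 0" "Y $ \<mu> $ \<mu> = 0" for \<mu>
    using a[of \<mu> \<mu>] by auto
  note s = a[of 2 1] a[of 3 1] a[of 4 1] a[of 3 2] a[of 4 2] a[of 4 3]
  \<comment> \<open>The witness for \<open>c\<close> is the entry (1, 1); the identity is then
    checked entry by entry.\<close>
  show "X ** dual Y + Y ** dual X = mat ((X ** dual Y + Y ** dual X) $ 1 $ 1)"
    unfolding vec_eq_iff forall_4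
    by (simp add: mat_def matrix_matrix_mult_def sum_4 dual_nth[OF assms(1)] dual_nth[OF assms(2)] s d)
qed

lemma hodge_eq_dual:
  "hodge g orient F = complex_of_real (orient * sqrt \<bar>det g\<bar>) *\<^sub>C dual (raise g F)"
  by (simp add: vec_eq_iff hodge_def dual_def volume_def levi_civita_def sum_distrib_left mult_ac)

section \<open>Orthonormal frames of self-dual bivectors\<close>

lemma lorentzian_invertible: "invertible g" if "lorentzian g"
proof -
  from that obtain P :: "real^4^4" where P: "transpose P ** g ** P =
      (\<chi> \<alpha> \<beta>. if \<alpha> = \<beta> then (if \<alpha> = 1 then - 1 else 1) else 0)" (is "_ = ?D")
    unfolding lorentzian_def by blast
  have "det ?D = (\<Prod>i\<in>UNIV. ?D $ i $ i)"
    by (rule det_diagonal) simp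
  then have "det ?D \<noteq> 0" by simp
  then have "det g \<noteq> 0"
    unfolding P[symmetric] by (simp add: det_mul)
  then show ?thesis by (simp add: invertible_det_nz)
qed

locale sd_frame =
  fixes g :: "real^4^4" and orient :: real and U :: "3 \<Rightarrow> tensor2"
  assumes lorentzian: "lorentzian g"
    and frame: "orthonormal_sd_frame g orient U"
begin

abbreviation G where "G \<equiv> inverse_metric g"

definition metric :: tensor2 where "metric = (\<chi> \<alpha> \<beta>. complex_of_real (g $ \<alpha> $ \<beta>))"

abbreviation Pi_U where "Pi_U \<equiv> Pi_tensor g U"

lemma metric_inverse: "metric ** G = mat 1" "G ** metric = mat 1"
proof -
  have inv: "g ** matrix_inv g = mat 1" "matrix_inv g ** g = mat 1"
    using someI_ex[of "\<lambda>B. g ** B = mat 1 \<and> B ** g = mat 1"] lorentzian_invertible[OF lorentzian]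
    by (auto simp: invertible_def matrix_inv_def)
  have *: "(\<chi> \<alpha> \<beta>. complex_of_real (A $ \<alpha> $ \<beta>)) ** (\<chi> \<alpha> \<beta>. complex_of_real (B $ \<alpha> $ \<beta>)) = mat 1"
    if "A ** B = mat 1" for A B :: "real^4^4"
    using that by (simp add: vec_eq_iff matrix_matrix_mult_def mat_def flip: of_real_mult of_real_sum)
  show "metric ** G = mat 1" "G ** metric = mat 1"
    unfolding metric_def inverse_metric_def ginv_def
    by (rule *, simp add: inv)+
qed

lemma metric_cancel [simp]: "A ** metric ** G = A" "A ** G ** metric = A"
  by (simp_all add: metric_inverse flip: matrix_mul_assoc)

text \<open>Identities are proved for the mixed-index matrices \<open>A ** G\<close>, where the
  Clifford algebra lives, and carried back to covariant tensors by this cancellation.\<close>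

lemma G_cancel: "A = B" if "A ** G = B ** G"
  by (metis that metric_cancel(2))

lemma G_symmetric [simp]: "transpose G = G"
proof -
  have g: "transpose g = g" using lorentzian by (simp add: lorentzian_def)
  have "transpose metric = metric"
    using arg_cong[OF g, of "\<lambda>A. A $ _ $ _"] by (simp add: metric_def vec_eq_iff transpose_def)
  then have "metric ** transpose G = mat 1"
    using metric_inverse(2) by (metis matrix_transpose_mul transpose_mat)
  then show ?thesis
    by (metis metric_inverse(2) matrix_mul_assoc matrix_mul_lid matrix_mul_rid)
qed

lemma G_real [simp]: "cnj_tensor G = G"
  by (simp add: vec_eq_iff inverse_metric_def ginv_def)

lemma inner2_eq: "inner2 g A B = trace (A ** G ** transpose B ** G)"
  by (simp add: inner2_eq_trace raise_eq matrix_transpose_mul matrix_mul_assoc)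

lemma inner2_commute: "inner2 g A B = inner2 g B A"
proof -
  have "inner2 g A B = trace (transpose (G ** (A ** G ** transpose B)))"
    unfolding inner2_eq trace_transpose by (rule trace_mul_sym)
  also have "\<dots> = inner2 g B A"
    by (simp add: inner2_eq matrix_transpose_mul matrix_mul_assoc)
  finally show ?thesis .
qed

lemma inner2_scale_left: "inner2 g (c *\<^sub>C A) B = c * inner2 g A B"
  and inner2_sum_left: "inner2 g (\<Sum>i\<in>I. f i) B = (\<Sum>i\<in>I. inner2 g (f i) B)"
  and inner2_add_left: "inner2 g (A + A') B = inner2 g A B + inner2 g A' B"
  by (simp_all add: inner2_eq cscale_mult_left trace_cscale sum_matrix_mult trace_sum
      matrix_add_rdistrib trace_add)

lemma inner2_uminus_left: "inner2 g (- A) B = - inner2 g A B"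
  using inner2_scale_left[of "- 1" A B] by simp

lemma sd_transpose: "transpose (U i) = - U i"
  and sd_hodge: "hodge g orient (U i) = \<i> *\<^sub>C U i"
  and sd_orthonormal: "sd_metric g (U i) (U j) = (if i = j then - 1 else 0)"
proof -
  have "U i \<in> sd_bivectors g orient"
    using frame ctensor.span_base[of "U i" "range U"] by (auto simp: orthonormal_sd_frame_def frame_of_def)
  then show "transpose (U i) = - U i" "hodge g orient (U i) = \<i> *\<^sub>C U i"
    by (simp_all add: sd_bivectors_def)
  show "sd_metric g (U i) (U j) = (if i = j then - 1 else 0)"
    using frame by (simp add: orthonormal_sd_frame_def)
qed

definition V :: "3 \<Rightarrow> tensor2" where "V i = cnj_tensor (U i)"

lemma V_transpose: "transpose (V i) = - V i"
  by (simp add: V_def sd_transpose cnj_tensor_uminus flip: cnj_tensor_transpose)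

lemma hodge_cnj: "hodge g orient (cnj_tensor F) = cnj_tensor (hodge g orient F)"
  by (simp add: vec_eq_iff hodge_def raise_def ginv_def)

text \<open>The Hodge operator is real, so conjugation turns the eigenvalue \<open>\<i>\<close> into
  its negative: the \<open>V i\<close> are anti-self-dual.\<close>

lemma V_hodge: "hodge g orient (V i) = (- \<i>) *\<^sub>C V i"
  by (simp add: V_def hodge_cnj sd_hodge cnj_tensor_cscale)

text \<open>For Hodge eigenvectors the duals in \<open>mult_dual_anticommute\<close> are multiples
  of the bivectors themselves. The eigenvalues appear crossed because each product contains the dual
  of its second factor.\<close>

lemma dual_product_scalar:
  assumes F: "transpose F = - F" "hodge g orient F = \<kappa> *\<^sub>C F"
    and H: "transpose H = - H" "hodge g orient H = \<mu> *\<^sub>C H"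
  obtains c where "\<mu> *\<^sub>C (F ** G ** (H ** G)) + \<kappa> *\<^sub>C (H ** G ** (F ** G)) = mat c"
proof -
  define k where "k = complex_of_real (orient * sqrt \<bar>det g\<bar>)"
  have r: "transpose (raise g A) = - raise g A" if "transpose A = - A" for A
    using that by (simp add: raise_eq matrix_transpose_mul matrix_mul_assoc matrix_mult_uminus_left
        matrix_mult_uminus_right)
  obtain c where "raise g F ** dual (raise g H) + raise g H ** dual (raise g F) = mat c"
    using mult_dual_anticommute[OF r[OF F(1)] r[OF H(1)]] by blast
  then have "raise g F ** (k *\<^sub>C dual (raise g H)) + raise g H ** (k *\<^sub>C dual (raise g F)) = mat (k * c)"
    by (simp add: cscale_mult_right vec_eq_iff mat_def flip: distrib_left)
  then have "raise g F ** (\<mu> *\<^sub>C H) + raise g H ** (\<kappa> *\<^sub>C F) = mat (k * c)"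
    unfolding k_def hodge_eq_dual[symmetric] F(2) H(2) .
  \<comment> \<open>Lowering the first index on the left and raising the last one on the right makes
    every factor mixed.\<close>
  then have "metric ** (raise g F ** (\<mu> *\<^sub>C H) + raise g H ** (\<kappa> *\<^sub>C F)) ** G = metric ** mat (k * c) ** G"
    by simp
  then have "\<mu> *\<^sub>C (F ** G ** (H ** G)) + \<kappa> *\<^sub>C (H ** G ** (F ** G)) = mat (k * c)"
    by (simp add: raise_eq matrix_add_ldistrib matrix_add_rdistrib cscale_mult_left cscale_mult_right
        matrix_mul_assoc metric_inverse mult_mat) (simp add: vec_eq_iff mat_def)
  then show ?thesis using that by blast
qed

text \<open>Equal Hodge eigenvalues make the anticommutator a scalar, and its trace identifies the
  scalar with minus \<open>sd_metric\<close>.\<close>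

lemma u_clifford: "clifford_triple (\<lambda>i. U i ** G)"
  unfolding clifford_triple_def
proof (intro allI)
  fix i j
  obtain c where "\<i> *\<^sub>C (U i ** G ** (U j ** G)) + \<i> *\<^sub>C (U j ** G ** (U i ** G)) = mat c"
    using dual_product_scalar[OF sd_transpose sd_hodge sd_transpose sd_hodge] by blast
  then have "(- \<i>) *\<^sub>C (\<i> *\<^sub>C (U i ** G ** (U j ** G) + U j ** G ** (U i ** G))) = (- \<i>) *\<^sub>C mat c"
    by (simp add: ctensor.scale_right_distrib)
  then obtain d where d: "U i ** G ** (U j ** G) + U j ** G ** (U i ** G) = mat d"
    using that[of "- \<i> * c"] by (simp add: vec_eq_iff mat_def)
  have "4 * d = 2 * trace (U i ** G ** (U j ** G))"
    using arg_cong[OF d, of trace] trace_mul_sym[of "U i ** G" "U j ** G"]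
    by (simp add: trace_add trace_mat)
  moreover have "inner2 g (U i) (U j) = - trace (U i ** G ** (U j ** G))"
    by (simp add: inner2_eq sd_transpose matrix_mult_uminus_left matrix_mult_uminus_right
        trace_uminus matrix_mul_assoc)
  ultimately have "d = - sd_metric g (U i) (U j)"
    by (simp add: sd_metric_def mult.commute)
  then show "U i ** G ** (U j ** G) + U j ** G ** (U i ** G) = mat (if i = j then 1 else 0)"
    using d sd_orthonormal by (cases "i = j") auto
qed

lemma v_clifford: "clifford_triple (\<lambda>i. V i ** G)"
  unfolding clifford_triple_def
proof (intro allI)
  fix i j
  have "U i ** G ** (U j ** G) + U j ** G ** (U i ** G) = mat (if i = j then 1 else 0)"
    using u_clifford by (simp add: clifford_triple_def)
  from arg_cong[OF this, of cnj_tensor]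
  show "V i ** G ** (V j ** G) + V j ** G ** (V i ** G) = mat (if i = j then 1 else 0)"
    by (simp add: cnj_tensor_add cnj_tensor_mult cnj_tensor_mat V_def split: if_splits)
qed

text \<open>Opposite Hodge eigenvalues produce the commutator instead; it is scalar and has trace
  zero, hence vanishes.\<close>

lemma u_v_commute: "U i ** G ** (V j ** G) = V j ** G ** (U i ** G)"
proof -
  obtain c where "(- \<i>) *\<^sub>C (U i ** G ** (V j ** G)) + \<i> *\<^sub>C (V j ** G ** (U i ** G)) = mat c"
    using dual_product_scalar[OF sd_transpose sd_hodge V_transpose V_hodge] by blast
  then have c: "\<i> *\<^sub>C (V j ** G ** (U i ** G) - U i ** G ** (V j ** G)) = mat c"
    by (simp add: vec_eq_iff algebra_simps)
  have "4 * c = 0"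
    using arg_cong[OF c, of trace] trace_mul_sym[of "U i ** G" "V j ** G"]
    by (simp add: trace_sub trace_mat trace_cscale)
  then show ?thesis using c by (simp add: vec_eq_iff)
qed

lemma Pi_eq: "Pi_U i j = U i ** G ** V j"
  by (simp add: Pi_tensor_def dot2_eq V_def)

lemma Pi_eq': "Pi_U i j = V j ** G ** U i"
proof (rule G_cancel)
  show "Pi_U i j ** G = V j ** G ** U i ** G"
    using u_v_commute[of i j] by (simp add: Pi_eq matrix_mul_assoc)
qed

text \<open>Transposition reverses two antisymmetric factors, so the signs cancel, and commutation
  restores the order.\<close>

lemma Pi_symmetric: "transpose (Pi_U i j) = Pi_U i j"
proof -
  have "transpose (Pi_U i j) = V j ** G ** U i"
    by (simp add: Pi_eq matrix_transpose_mul sd_transpose V_transpose matrix_mul_assoc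
        matrix_mult_uminus_left matrix_mult_uminus_right)
  then show ?thesis by (simp add: Pi_eq')
qed

lemma inner2_U: "inner2 g A (U i) = - trace (A ** G ** (U i ** G))"
  and inner2_V: "inner2 g A (V i) = - trace (A ** G ** (V i ** G))"
  by (simp_all add: inner2_eq sd_transpose V_transpose matrix_mult_uminus_left
      matrix_mult_uminus_right trace_uminus matrix_mul_assoc)

lemma inner2_Pi: "inner2 g A (Pi_U i j) = trace (A ** G ** (U i ** G ** (V j ** G)))"
  by (simp add: inner2_eq Pi_symmetric) (simp add: Pi_eq matrix_mul_assoc)

text \<open>This is \<open>clifford_expansion\<close> of \<open>A ** G\<close> with the last
  \<open>G\<close> cancelled. Antisymmetry of the bivectors accounts for the minus signs when traces
  become inner products.\<close>

lemma tensor_expansion: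
  "A = (trace (A ** G) / 4) *\<^sub>C metric
    + (- 1/2) *\<^sub>C (\<Sum>i\<in>UNIV. inner2 g A (U i) *\<^sub>C U i)
    + (- 1/2) *\<^sub>C (\<Sum>i\<in>UNIV. inner2 g A (V i) *\<^sub>C V i)
    + (\<Sum>i\<in>UNIV. \<Sum>j\<in>UNIV. inner2 g A (Pi_U i j) *\<^sub>C Pi_U i j)" (is "A = ?B")
proof (rule G_cancel)
  have "?B ** G = A ** G"
    by (subst (2) clifford_expansion[OF u_clifford v_clifford u_v_commute, of "A ** G"])
      (simp add: matrix_add_rdistrib cscale_mult_left sum_matrix_mult metric_inverse inner2_U inner2_V
        inner2_Pi sum_negf matrix_mult_uminus_left, simp add: Pi_eq matrix_mul_assoc)
  then show "A ** G = ?B ** G" by simp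
qed

section \<open>Orthogonality of the frame elements and expansions by symmetry type\<close>

lemma inner2_U_U: "inner2 g (U i) (U j) = (if i = j then - 2 else 0)"
  using sd_orthonormal[of i j] by (simp add: sd_metric_def split: if_splits)

lemma inner2_cnj: "inner2 g (cnj_tensor A) (cnj_tensor B) = cnj (inner2 g A B)"
  unfolding inner2_eq trace_cnj_tensor[symmetric]
  by (simp add: cnj_tensor_mult cnj_tensor_transpose)

lemma inner2_U_V: "inner2 g (U i) (V j) = 0" "inner2 g (V j) (U i) = 0"
proof -
  show "inner2 g (U i) (V j) = 0"
    using clifford_trace_single[OF u_clifford, of "V j ** G" i] u_v_commute
    by (simp add: inner2_V)
  then show "inner2 g (V j) (U i) = 0" by (simp add: inner2_commute)
qed

lemma inner2_Pi_Pi: "inner2 g (Pi_U i j) (Pi_U k l) = (if i = k \<and> j = l then 1 else 0)"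
  using clifford_product_orthonormal[OF u_clifford v_clifford u_v_commute, of "Some i" "Some j" "Some k" "Some l"]
  by (simp add: inner2_Pi) (auto simp: Pi_eq matrix_mul_assoc)

lemma inner2_symmetric_antisymmetric:
  assumes "transpose A = A" "transpose B = - B"
  shows "inner2 g A B = 0"
proof -
  have "inner2 g A B = trace (B ** G ** A ** G)"
    using assms by (subst inner2_commute) (simp add: inner2_eq)
  also have "\<dots> = - inner2 g A B"
    using trace_mul_sym[of "B ** G" "A ** G"] assms
    by (simp add: inner2_eq matrix_mult_uminus_left matrix_mult_uminus_right trace_uminus matrix_mul_assoc)
  finally show ?thesis by simp
qed

lemma antisymmetric_traceless: "trace (A ** G) = 0" if "transpose A = - A"
proof -
  have "trace (A ** G) = trace (transpose (A ** G))" by (simp add: trace_transpose)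
  also have "\<dots> = - trace (A ** G)"
    using that trace_mul_sym[of G A]
    by (simp add: matrix_transpose_mul matrix_mult_uminus_right trace_uminus)
  finally show ?thesis by simp
qed

text \<open>The metric and the \<open>\<Pi>\<close> tensors are symmetric, so only the self-dual and
  anti-self-dual terms of \<open>tensor_expansion\<close> survive.\<close>

lemma antisymmetric_expansion:
  assumes "transpose A = - A"
  shows "A = (\<Sum>i\<in>UNIV. (- inner2 g A (U i) / 2) *\<^sub>C U i) + (\<Sum>i\<in>UNIV. (- inner2 g A (V i) / 2) *\<^sub>C V i)"
proof -
  have "inner2 g A (Pi_U i j) = 0" for i j
    using inner2_symmetric_antisymmetric[OF Pi_symmetric assms] inner2_commute by simp
  then show ?thesis
    by (subst tensor_expansion) (simp add: antisymmetric_traceless[OF assms] ctensor.scale_sum_right sum_negf)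
qed

lemma traceless_symmetric_iff: "A \<in> traceless_symmetric g \<longleftrightarrow> transpose A = A \<and> trace (A ** G) = 0"
proof -
  have "(\<Sum>\<alpha>\<in>UNIV. \<Sum>\<beta>\<in>UNIV. ginv g \<alpha> \<beta> * A $ \<alpha> $ \<beta>) = trace (transpose G ** A)"
    unfolding trace_def matrix_matrix_mult_def transpose_def
    by (subst sum.swap) (simp add: ginv_nth)
  also have "\<dots> = trace (A ** G)"
    using trace_mul_sym[of G A] by simp
  finally show ?thesis by (simp add: traceless_symmetric_def)
qed

text \<open>The trace is, up to sign, the inner product of a self-dual with an anti-self-dual
  bivector, which is zero.\<close>

lemma Pi_traceless_symmetric: "Pi_U i j \<in> traceless_symmetric g"
proof -
  have "trace (Pi_U i j ** G) = - inner2 g (U i) (V j)"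
    by (simp add: inner2_V Pi_eq matrix_mul_assoc)
  then show ?thesis by (simp add: traceless_symmetric_iff Pi_symmetric inner2_U_V)
qed

lemma traceless_symmetric_expansion:
  assumes "A \<in> traceless_symmetric g"
  shows "A = (\<Sum>i\<in>UNIV. \<Sum>j\<in>UNIV. inner2 g A (Pi_U i j) *\<^sub>C Pi_U i j)"
proof -
  have "transpose A = A" "trace (A ** G) = 0"
    using assms by (simp_all add: traceless_symmetric_iff)
  then show ?thesis
    using inner2_symmetric_antisymmetric[OF _ sd_transpose] inner2_symmetric_antisymmetric[OF _ V_transpose]
    by (subst tensor_expansion) simp
qed

lemma inner2_Pi_combination:
  "inner2 g (\<Sum>i\<in>UNIV. \<Sum>j\<in>UNIV. c i j *\<^sub>C Pi_U i j) (Pi_U k l) = c k l"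
proof -
  \<comment> \<open>The condition is written as nested conditionals so that each of the two sums
    collapses separately.\<close>
  have "inner2 g (\<Sum>i\<in>UNIV. \<Sum>j\<in>UNIV. c i j *\<^sub>C Pi_U i j) (Pi_U k l) =
    (\<Sum>i\<in>UNIV. \<Sum>j\<in>UNIV. if i = k then if j = l then c i j else 0 else 0)"
    by (simp add: inner2_sum_left inner2_scale_left inner2_Pi_Pi if_distrib cong: if_cong)
      (intro sum.cong refl; simp)
  also have "\<dots> = (\<Sum>i\<in>UNIV. if i = k then c i l else 0)"
    by (intro sum.cong refl) simp
  finally show ?thesis by simp
qed

lemma inj_Pi: "inj (\<lambda>(i, j). Pi_U i j)"
proof (rule injI, clarify)
  fix i j k l assume "Pi_U i j = Pi_U k l"
  then have "inner2 g (Pi_U i j) (Pi_U k l) = inner2 g (Pi_U k l) (Pi_U k l)" by simp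
  then show "i = k \<and> j = l" by (simp add: inner2_Pi_Pi split: if_splits)
qed

lemma traceless_symmetric_subspace: "ctensor.subspace (traceless_symmetric g)"
proof (rule ctensor.subspaceI)
  show "0 \<in> traceless_symmetric g"
    by (simp add: traceless_symmetric_def vec_eq_iff transpose_def)
  show "A + B \<in> traceless_symmetric g" if "A \<in> traceless_symmetric g" "B \<in> traceless_symmetric g" for A B
    using that by (simp add: traceless_symmetric_iff matrix_add_rdistrib trace_add)
      (simp add: vec_eq_iff transpose_def)
  show "c *\<^sub>C A \<in> traceless_symmetric g" if "A \<in> traceless_symmetric g" for c A
    using that by (simp add: traceless_symmetric_iff cscale_mult_left trace_cscale transpose_cscale)
qed

text \<open>Pairing a vanishing combination with one \<open>\<Pi>\<close> isolates its coefficient,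
  which gives independence; spanning is \<open>traceless_symmetric_expansion\<close>.\<close>

lemma Pi_frame: "frame_of (traceless_symmetric g) (\<lambda>(i, j). Pi_U i j)"
proof -
  let ?P = "\<lambda>(i, j). Pi_U i j"
  have "ctensor.independent (range ?P)"
  proof -
    have "c (Pi_U i j) = 0" if "(\<Sum>A\<in>range ?P. c A *\<^sub>C A) = 0" for c i j
    proof -
      from that
      have "(\<Sum>p\<in>UNIV. c (?P p) *\<^sub>C ?P p) = 0"
      by (subst (asm) sum.reindex[OF inj_Pi]) (simp add: o_def)
    then have "(\<Sum>i\<in>UNIV. \<Sum>j\<in>UNIV. c (Pi_U i j) *\<^sub>C Pi_U i j) = 0"
      by (simp add: sum.cartesian_product case_prod_unfold)
      then show ?thesis
        using inner2_Pi_combination[of "\<lambda>i j. c (Pi_U i j)" i j] by (simp add: inner2_def)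
    qed
    then show ?thesis
      by (subst ctensor.dependent_finite) auto
  qed
  moreover have "ctensor.span (range ?P) = traceless_symmetric g"
  proof
    show "ctensor.span (range ?P) \<subseteq> traceless_symmetric g"
      by (rule ctensor.span_minimal) (auto simp: Pi_traceless_symmetric traceless_symmetric_subspace)
    show "traceless_symmetric g \<subseteq> ctensor.span (range ?P)"
    proof
      fix A assume "A \<in> traceless_symmetric g"
      moreover have "Pi_U i j \<in> range ?P" for i j
        by (rule image_eqI[of _ _ "(i, j)"]) auto
      ultimately show "A \<in> ctensor.span (range ?P)"
        by (subst traceless_symmetric_expansion)
          (assumption, intro ctensor.span_sum ctensor.span_scale ctensor.span_base)
    qed
  qed
  ultimately show ?thesis
    using inj_Pi by (simp add: frame_of_def)
qed

section \<open>Eigenframes of tensors diagonal in the \<open>\<Pi>\<close> frame\<close>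

definition Pi_diagonal :: "tensor4 \<Rightarrow> (3 \<Rightarrow> 3 \<Rightarrow> complex) \<Rightarrow> bool" where
  "Pi_diagonal T m \<longleftrightarrow> (\<forall>\<alpha> \<beta> \<mu> \<nu>. T $ \<alpha> $ \<beta> $ \<mu> $ \<nu> =
    (\<Sum>i\<in>UNIV. \<Sum>j\<in>UNIV. m i j * Pi_U i j $ \<alpha> $ \<beta> * Pi_U i j $ \<mu> $ \<nu>))"

lemma contract_Pi_diagonal:
  assumes "Pi_diagonal T m"
  shows "contract g T A = (\<Sum>i\<in>UNIV. \<Sum>j\<in>UNIV. (m i j * inner2 g A (Pi_U i j)) *\<^sub>C Pi_U i j)"
proof -
  have "contract g T A $ \<alpha> $ \<beta> = (\<Sum>i\<in>UNIV. \<Sum>j\<in>UNIV. m i j * inner2 g (Pi_U i j) A * Pi_U i j $ \<alpha> $ \<beta>)" for \<alpha> \<beta>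
    using assms unfolding Pi_diagonal_def contract_def inner2_def
    by (simp add: sum_distrib_left sum_distrib_right sum.swap[of _ "UNIV :: 3 set" "UNIV :: 4 set"] mult_ac)
  then show ?thesis by (simp add: vec_eq_iff inner2_commute)
qed

lemma Pi_eigentensor:
  assumes "Pi_diagonal T m"
  shows "eigentensor g T (m k l) (Pi_U k l)"
proof -
  have "(\<Sum>j\<in>UNIV. (m i j * inner2 g (Pi_U k l) (Pi_U i j)) *\<^sub>C Pi_U i j) =
      (if i = k then m k l *\<^sub>C Pi_U k l else 0)" for i
    by (auto simp: inner2_Pi_Pi if_distrib if_distribR cong: if_cong)
  then have "contract g T (Pi_U k l) = m k l *\<^sub>C Pi_U k l"
    by (simp add: contract_Pi_diagonal[OF assms])
  moreover have "Pi_U k l \<noteq> 0"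
    using inner2_Pi_Pi[of k l k l] by (auto simp: inner2_def)
  ultimately show ?thesis
    by (simp add: eigentensor_def Pi_traceless_symmetric)
qed

lemma Pi_normalized_eigenframe:
  assumes "Pi_diagonal T m"
  shows "normalized_eigenframe g T (\<lambda>(i, j). Pi_U i j)"
  using Pi_frame Pi_eigentensor[OF assms]
  by (auto simp: normalized_eigenframe_def inner2_Pi_Pi)

text \<open>The eigenvalue equation reads \<open>(m i j - c) * \<beta> i j = 0\<close> in
  components. With distinct \<open>m i j\<close> a single component survives, and normalization
  forces its square to be 1.\<close>

lemma normalized_eigentensor_unique:
  assumes T: "Pi_diagonal T m" and "inj (\<lambda>(i, j). m i j)"
    and A: "eigentensor g T c A" "inner2 g A A = 1"
  obtains k l s where "s = 1 \<or> s = - 1" "A = s *\<^sub>C Pi_U k l"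
proof -
  define \<beta> where "\<beta> i j = inner2 g A (Pi_U i j)" for i j
  have A_eq: "A = (\<Sum>i\<in>UNIV. \<Sum>j\<in>UNIV. \<beta> i j *\<^sub>C Pi_U i j)"
    using A(1) unfolding \<beta>_def eigentensor_def by (intro traceless_symmetric_expansion) simp
  have ev: "m i j * \<beta> i j = c * \<beta> i j" for i j
  proof -
    have "inner2 g (contract g T A) (Pi_U i j) = m i j * \<beta> i j"
      by (simp add: contract_Pi_diagonal[OF T] inner2_Pi_combination[of "\<lambda>i j. m i j * inner2 g A (Pi_U i j)"] \<beta>_def)
    then show ?thesis
      using A(1) inner2_scale_left[of c A] unfolding eigentensor_def \<beta>_def by metis
  qed
  have "A \<noteq> 0" using A(1) by (simp add: eigentensor_def)
  have "A = 0" if "\<And>k l. \<beta> k l = 0"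
    using A_eq by (simp add: that)
  with \<open>A \<noteq> 0\<close> obtain k l where kl: "\<beta> k l \<noteq> 0" by blast
  have "m k l = c" using ev[of k l] kl by simp
  then have z: "\<beta> i j = 0" if "(i, j) \<noteq> (k, l)" for i j
    using ev[of i j] injD[OF assms(2), of "(i, j)" "(k, l)"] that by auto
  have "(\<Sum>j\<in>UNIV. \<beta> i j *\<^sub>C Pi_U i j) =
      (\<Sum>j\<in>UNIV. if i = k then if j = l then \<beta> k l *\<^sub>C Pi_U k l else 0 else 0)" for i
    using z by (intro sum.cong) auto
  moreover have "(\<Sum>j\<in>UNIV. if i = k then if j = l then \<beta> k l *\<^sub>C Pi_U k l else 0 else 0) = (if i = k then \<beta> k l *\<^sub>C Pi_U k l else 0)" for i
    by simp
  ultimately have s: "(\<Sum>j\<in>UNIV. \<beta> i j *\<^sub>C Pi_U i j) = (if i = k then \<beta> k l *\<^sub>C Pi_U k l else 0)" for i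
    by simp
  have "(\<Sum>i\<in>UNIV. \<Sum>j\<in>UNIV. \<beta> i j *\<^sub>C Pi_U i j) = \<beta> k l *\<^sub>C Pi_U k l"
    unfolding s by simp
  with A_eq have A': "A = \<beta> k l *\<^sub>C Pi_U k l" by simp
  have "inner2 g A A = \<beta> k l * inner2 g (Pi_U k l) A"
    using inner2_scale_left[of "\<beta> k l" "Pi_U k l" A] A' by simp
  also have "inner2 g (Pi_U k l) A = \<beta> k l"
    by (simp add: \<beta>_def inner2_commute)
  finally have "(\<beta> k l)\<^sup>2 = 1"
    using A(2) by (simp add: power2_eq_square)
  then show ?thesis
    using that A' by (metis power2_eq_1_iff)
qed

text \<open>Every member is a signed \<open>\<Pi>\<close>. Two members with the same label would be
  proportional, against independence, so the labelling is injective and therefore a bijection of the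
  nine labels.\<close>

lemma normalized_eigenframe_unique:
  assumes T: "Pi_diagonal T m" and inj: "inj (\<lambda>(i, j). m i j)"
    and B: "normalized_eigenframe g T (B :: 3 \<times> 3 \<Rightarrow> tensor2)"
  shows "\<exists>(p :: 3 \<times> 3 \<Rightarrow> 3 \<times> 3) (s :: 3 \<times> 3 \<Rightarrow> complex). bij p \<and> (\<forall>n. s n = 1 \<or> s n = - 1) \<and>
    (\<forall>n. B n = s n *\<^sub>C Pi_U (fst (p n)) (snd (p n)))"
proof -
  have "\<exists>q s. (s = 1 \<or> s = - 1) \<and> B n = s *\<^sub>C Pi_U (fst q) (snd q)" for n
    using B normalized_eigentensor_unique[OF T inj, of _ "B n"]
    unfolding normalized_eigenframe_def by (metis fst_conv snd_conv)
  then obtain p s where s: "\<And>n. s n = 1 \<or> s n = - 1"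
    and p: "\<And>n. B n = s n *\<^sub>C Pi_U (fst (p n)) (snd (p n))"
    by metis
  have B': "inj B" "ctensor.independent (range B)"
    using B by (simp_all add: normalized_eigenframe_def frame_of_def)
  have "inj p"
  proof (rule injI, rule ccontr)
    fix n' n assume "p n' = p n" "n' \<noteq> n"
    \<comment> \<open>A sign is its own inverse, so multiplying by \<open>s n\<close> solves the
      equation of \<open>B n\<close> for the common \<open>\<Pi>\<close>.\<close>
    then have "B n' = (s n' * s n) *\<^sub>C B n"
      using s[of n] p[of n'] p[of n] by auto
    moreover have "B n \<in> ctensor.span (range B - {B n'})"
      using \<open>n' \<noteq> n\<close> B'(1) by (intro ctensor.span_base) (auto dest: injD)
    ultimately have "B n' \<in> ctensor.span (range B - {B n'})"
      by (metis ctensor.span_scale)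
    then show False
      using B'(2) unfolding ctensor.dependent_def by blast
  qed
  then have "bij p" by (simp add: bij_def finite_UNIV_inj_surj)
  then show ?thesis using s p by blast
qed

end

section \<open>The Weyl tensor in a frame of eigenbivectors\<close>

locale weyl_frame = sd_frame +
  fixes W :: rtensor4 and \<rho> :: "3 \<Rightarrow> complex"
  assumes weyl: "weyl_tensor g W"
    and eigen: "bivector_map g (sd_weyl g orient W) (U i) = \<rho> i *\<^sub>C U i"
begin

text \<open>Fixing the second index pair turns \<open>W\<close> into a family of bivectors to which
  the two-tensor expansions apply.\<close>

definition slice :: "4 \<Rightarrow> 4 \<Rightarrow> tensor2" where
  "slice \<mu> \<nu> = (\<chi> \<alpha> \<beta>. complex_of_real (W $ \<alpha> $ \<beta> $ \<mu> $ \<nu>))"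

lemma slice_nth [simp]: "slice \<mu> \<nu> $ \<alpha> $ \<beta> = complex_of_real (W $ \<alpha> $ \<beta> $ \<mu> $ \<nu>)"
  by (simp add: slice_def)

lemma W_symmetries:
  "W $ \<alpha> $ \<beta> $ \<mu> $ \<nu> = - W $ \<beta> $ \<alpha> $ \<mu> $ \<nu>"
  "W $ \<alpha> $ \<beta> $ \<mu> $ \<nu> = - W $ \<alpha> $ \<beta> $ \<nu> $ \<mu>"
  "W $ \<alpha> $ \<beta> $ \<mu> $ \<nu> = W $ \<mu> $ \<nu> $ \<alpha> $ \<beta>"
  "W $ \<alpha> $ \<beta> $ \<mu> $ \<nu> + W $ \<alpha> $ \<mu> $ \<nu> $ \<beta> + W $ \<alpha> $ \<nu> $ \<beta> $ \<mu> = 0"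
  using weyl unfolding weyl_tensor_def by blast+

lemma slice_antisymmetric: "transpose (slice \<mu> \<nu>) = - slice \<mu> \<nu>" "slice \<mu> \<nu> = - slice \<nu> \<mu>"
proof -
  have "transpose (slice \<mu> \<nu>) $ \<alpha> $ \<beta> = (- slice \<mu> \<nu>) $ \<alpha> $ \<beta>" for \<alpha> \<beta>
    using W_symmetries(1)[of \<beta> \<alpha> \<mu> \<nu>] by (simp add: transpose_def)
  then show "transpose (slice \<mu> \<nu>) = - slice \<mu> \<nu>" by (simp only: vec_eq_iff) blast
  have "slice \<mu> \<nu> $ \<alpha> $ \<beta> = (- slice \<nu> \<mu>) $ \<alpha> $ \<beta>" for \<alpha> \<beta>
    using W_symmetries(2)[of \<alpha> \<beta> \<mu> \<nu>] by simp
  then show "slice \<mu> \<nu> = - slice \<nu> \<mu>" by (simp only: vec_eq_iff) blast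
qed

definition weyl_coeff :: "3 \<Rightarrow> tensor2" where
  "weyl_coeff i = (\<chi> \<mu> \<nu>. - inner2 g (slice \<mu> \<nu>) (U i) / 2)"

lemma weyl_coeff_nth: "weyl_coeff i $ \<mu> $ \<nu> = - inner2 g (slice \<mu> \<nu>) (U i) / 2"
  by (simp add: weyl_coeff_def)

text \<open>Since \<open>W\<close> is real, its anti-self-dual components are the conjugates of the
  self-dual ones.\<close>

lemma slice_expansion:
  "slice \<mu> \<nu> = (\<Sum>i\<in>UNIV. weyl_coeff i $ \<mu> $ \<nu> *\<^sub>C U i) + (\<Sum>i\<in>UNIV. cnj (weyl_coeff i $ \<mu> $ \<nu>) *\<^sub>C V i)"
proof -
  have "cnj_tensor (slice \<mu> \<nu>) = slice \<mu> \<nu>"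
    by (simp add: vec_eq_iff)
  then have "inner2 g (slice \<mu> \<nu>) (V i) = cnj (inner2 g (slice \<mu> \<nu>) (U i))" for i
    using inner2_cnj[of "slice \<mu> \<nu>" "U i"] by (simp add: V_def)
  then show ?thesis
    by (subst antisymmetric_expansion[OF slice_antisymmetric(1)]) (simp add: weyl_coeff_nth)
qed

text \<open>Half of identity minus \<open>\<i>\<close> times Hodge is the projector onto the
  self-dual part: it is 1 on the eigenvalue \<open>\<i>\<close> and 0 on its negative.\<close>

lemma sd_weyl_slice:
  "sd_weyl g orient W $ \<alpha> $ \<beta> $ \<mu> $ \<nu> = (\<Sum>i\<in>UNIV. U i $ \<alpha> $ \<beta> * weyl_coeff i $ \<mu> $ \<nu>)"
proof -
  let ?c = "\<lambda>i. weyl_coeff i $ \<mu> $ \<nu>"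
  have "hodge g orient (slice \<mu> \<nu>) = (\<Sum>i\<in>UNIV. ?c i *\<^sub>C \<i> *\<^sub>C U i) + (\<Sum>i\<in>UNIV. cnj (?c i) *\<^sub>C (- \<i>) *\<^sub>C V i)"
    by (subst slice_expansion) (simp add: hodge_add hodge_sum hodge_scale sd_hodge V_hodge)
  then have h: "hodge g orient (slice \<mu> \<nu>) $ \<alpha> $ \<beta> =
      \<i> * (\<Sum>i\<in>UNIV. ?c i * U i $ \<alpha> $ \<beta>) - \<i> * (\<Sum>i\<in>UNIV. cnj (?c i) * V i $ \<alpha> $ \<beta>)"
    by (simp add: sum_negf sum_distrib_left mult_ac)
  have s: "slice \<mu> \<nu> $ \<alpha> $ \<beta> =
      (\<Sum>i\<in>UNIV. ?c i * U i $ \<alpha> $ \<beta>) + (\<Sum>i\<in>UNIV. cnj (?c i) * V i $ \<alpha> $ \<beta>)"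
    by (subst slice_expansion) simp
  have "sd_weyl g orient W $ \<alpha> $ \<beta> $ \<mu> $ \<nu> =
      (slice \<mu> \<nu> $ \<alpha> $ \<beta> - \<i> * hodge g orient (slice \<mu> \<nu>) $ \<alpha> $ \<beta>) / 2"
    by (simp add: sd_weyl_def hodge4_def complexify_def slice_def)
  also have "\<dots> = (\<Sum>i\<in>UNIV. ?c i * U i $ \<alpha> $ \<beta>)"
    unfolding h s by (simp add: algebra_simps)
  finally show ?thesis by (simp add: mult.commute)
qed

definition weyl_form :: "tensor2 \<Rightarrow> tensor2 \<Rightarrow> complex" where
  "weyl_form X Y = (\<Sum>\<alpha>\<in>UNIV. \<Sum>\<beta>\<in>UNIV. \<Sum>\<mu>\<in>UNIV. \<Sum>\<nu>\<in>UNIV.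
    complex_of_real (W $ \<alpha> $ \<beta> $ \<mu> $ \<nu>) * raise g X $ \<alpha> $ \<beta> * raise g Y $ \<mu> $ \<nu>)"

lemma weyl_form_swap:
  "weyl_form X Y = (\<Sum>\<mu>\<in>UNIV. \<Sum>\<nu>\<in>UNIV. \<Sum>\<alpha>\<in>UNIV. \<Sum>\<beta>\<in>UNIV.
    complex_of_real (W $ \<alpha> $ \<beta> $ \<mu> $ \<nu>) * raise g X $ \<alpha> $ \<beta> * raise g Y $ \<mu> $ \<nu>)"
proof -
  \<comment> \<open>Packing index pairs into single indices reduces the exchange of four sums to one
    \<open>sum.swap\<close>.\<close>
  have *: "(\<Sum>\<alpha>\<in>UNIV. \<Sum>\<beta>\<in>UNIV. \<Sum>\<mu>\<in>UNIV. \<Sum>\<nu>\<in>UNIV. f (\<alpha>, \<beta>) (\<mu>, \<nu>)) =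
    (\<Sum>\<mu>\<in>UNIV. \<Sum>\<nu>\<in>UNIV. \<Sum>\<alpha>\<in>UNIV. \<Sum>\<beta>\<in>UNIV. f (\<alpha>, \<beta>) (\<mu>, \<nu>))" for f :: "4 \<times> 4 \<Rightarrow> 4 \<times> 4 \<Rightarrow> complex"
  proof -
    have sp: "(\<Sum>\<alpha>\<in>UNIV. \<Sum>\<beta>\<in>UNIV. h (\<alpha>, \<beta>)) = (\<Sum>p\<in>UNIV. h p)" for h :: "4 \<times> 4 \<Rightarrow> complex"
      by (simp add: sum.cartesian_product)
    have pairs: "(\<Sum>\<alpha>\<in>UNIV. \<Sum>\<beta>\<in>UNIV. \<Sum>\<mu>\<in>UNIV. \<Sum>\<nu>\<in>UNIV. f (\<alpha>, \<beta>) (\<mu>, \<nu>)) = (\<Sum>p\<in>UNIV. \<Sum>q\<in>UNIV. f p q)"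
      for f :: "4 \<times> 4 \<Rightarrow> 4 \<times> 4 \<Rightarrow> complex"
      using sp[of "\<lambda>p. \<Sum>q\<in>UNIV. f p q"] by (simp only: sp[of "f _"])
    show ?thesis
      unfolding pairs pairs[of "\<lambda>q p. f p q"] by (rule sum.swap)
  qed
  show ?thesis
    unfolding weyl_form_def
    by (rule *[of "\<lambda>(\<alpha>, \<beta>) (\<mu>, \<nu>). complex_of_real (W $ \<alpha> $ \<beta> $ \<mu> $ \<nu>) * raise g X $ \<alpha> $ \<beta> *
      raise g Y $ \<mu> $ \<nu>", simplified])
qed

lemma weyl_form_commute: "weyl_form X Y = weyl_form Y X"
proof -
  have "complex_of_real (W $ \<alpha> $ \<beta> $ \<mu> $ \<nu>) * raise g X $ \<alpha> $ \<beta> * raise g Y $ \<mu> $ \<nu> =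
      complex_of_real (W $ \<mu> $ \<nu> $ \<alpha> $ \<beta>) * raise g Y $ \<mu> $ \<nu> * raise g X $ \<alpha> $ \<beta>" for \<alpha> \<beta> \<mu> \<nu>
    using W_symmetries(3)[of \<alpha> \<beta> \<mu> \<nu>] by simp
  then show ?thesis
    unfolding weyl_form_swap[of X Y] weyl_form_def[of Y X] by (intro sum.cong refl)
qed

lemma cnj_weyl_form: "cnj (weyl_form X Y) = weyl_form (cnj_tensor X) (cnj_tensor Y)"
proof -
  have "cnj_tensor (raise g A) = raise g (cnj_tensor A)" for A
    by (simp add: raise_eq cnj_tensor_mult)
  then have "cnj (raise g A $ \<alpha> $ \<beta>) = raise g (cnj_tensor A) $ \<alpha> $ \<beta>" for A \<alpha> \<beta>
    by (metis cnj_tensor_nth)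
  then show ?thesis by (simp add: weyl_form_def)
qed

lemma inner2_weyl_coeff: "inner2 g (weyl_coeff i) Y = - weyl_form (U i) Y / 2"
proof -
  have "- weyl_form (U i) Y / 2 = (\<Sum>\<mu>\<in>UNIV. \<Sum>\<nu>\<in>UNIV. weyl_coeff i $ \<mu> $ \<nu> * raise g Y $ \<mu> $ \<nu>)"
    unfolding weyl_form_swap
    by (simp add: weyl_coeff_nth inner2_def sum_distrib_right sum_divide_distrib sum_negf)
  then show ?thesis by (simp add: inner2_def)
qed

lemma weyl_coeff_antisymmetric: "transpose (weyl_coeff i) = - weyl_coeff i"
proof -
  have "weyl_coeff i $ \<nu> $ \<mu> = - weyl_coeff i $ \<mu> $ \<nu>" for \<mu> \<nu>
    unfolding weyl_coeff_nth by (subst slice_antisymmetric(2)) (simp add: inner2_uminus_left)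
  then have "transpose (weyl_coeff i) $ \<mu> $ \<nu> = (- weyl_coeff i) $ \<mu> $ \<nu>" for \<mu> \<nu>
    unfolding transpose_def vec_lambda_beta uminus_vec_def .
  then show ?thesis by (simp only: vec_eq_iff) blast
qed

lemma contract_sd_weyl:
  "contract g (sd_weyl g orient W) A = (\<Sum>i\<in>UNIV. inner2 g (weyl_coeff i) A *\<^sub>C U i)"
proof -
  have "contract g (sd_weyl g orient W) A $ \<alpha> $ \<beta> =
      (\<Sum>i\<in>UNIV. \<Sum>\<mu>\<in>UNIV. \<Sum>\<nu>\<in>UNIV. U i $ \<alpha> $ \<beta> * (weyl_coeff i $ \<mu> $ \<nu> * raise g A $ \<mu> $ \<nu>))" for \<alpha> \<beta>
    by (simp add: contract_def sd_weyl_slice sum_distrib_right mult.assoc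
        sum.swap[of _ "UNIV :: 3 set" "UNIV :: 4 set"])
  then show ?thesis
    by (simp add: vec_eq_iff inner2_def sum_distrib_left mult.commute)
qed

text \<open>The eigenvalue equation fixes the components of \<open>weyl_coeff\<close> along the
  \<open>U j\<close>; those along the \<open>V j\<close> have to come from the trace
  condition.\<close>

lemma inner2_weyl_coeff_U: "inner2 g (weyl_coeff i) (U j) = (if i = j then 2 * \<rho> i else 0)"
proof -
  have "inner2 g (contract g (sd_weyl g orient W) (U j)) (U i) = - 2 * inner2 g (weyl_coeff i) (U j)"
    by (simp add: contract_sd_weyl inner2_sum_left inner2_scale_left inner2_U_U if_distrib cong: if_cong)
  moreover have "contract g (sd_weyl g orient W) (U j) = (2 * \<rho> j) *\<^sub>C U j"
  proof -
    have "2 *\<^sub>C (1/2) *\<^sub>C contract g (sd_weyl g orient W) (U j) = 2 *\<^sub>C \<rho> j *\<^sub>C U j"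
      using eigen[of j] by (simp add: bivector_map_def)
    then show ?thesis by simp
  qed
  ultimately have "- 2 * inner2 g (weyl_coeff i) (U j) = 2 * \<rho> j * inner2 g (U j) (U i)"
    by (metis inner2_scale_left)
  then show ?thesis
    by (cases "i = j") (simp_all add: inner2_U_U)
qed

text \<open>The component of \<open>W\<close> that mixes self-dual and anti-self-dual bivectors.\<close>

definition mixed :: "3 \<Rightarrow> 3 \<Rightarrow> complex" where "mixed i j = weyl_form (U i) (V j) / 4"

text \<open>Conjugation exchanges self-dual and anti-self-dual arguments, and the pair symmetry of
  \<open>W\<close> puts them back: \<open>mixed\<close> is a Hermitian matrix.\<close>

lemma cnj_mixed: "cnj (mixed i j) = mixed j i"
  using weyl_form_commute[of "V i" "U j"] by (simp add: mixed_def cnj_weyl_form V_def)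

lemma weyl_coeff_eq: "weyl_coeff i = (- \<rho> i) *\<^sub>C U i + (\<Sum>j\<in>UNIV. mixed i j *\<^sub>C V j)"
proof -
  have "(\<Sum>j\<in>UNIV. (- inner2 g (weyl_coeff i) (U j) / 2) *\<^sub>C U j) = (\<Sum>j\<in>UNIV. if i = j then (- \<rho> i) *\<^sub>C U i else 0)"
    by (intro sum.cong refl) (simp add: inner2_weyl_coeff_U)
  moreover have "- inner2 g (weyl_coeff i) (V j) / 2 = mixed i j" for j
    by (simp add: inner2_weyl_coeff mixed_def)
  ultimately show ?thesis
    using antisymmetric_expansion[OF weyl_coeff_antisymmetric, of i] by simp
qed

section \<open>Consequences of the trace condition\<close>

lemma U_square: "U i ** G ** U i = (1/2) *\<^sub>C metric"
  and V_square: "V i ** G ** V i = (1/2) *\<^sub>C metric"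
proof -
  have "(1/2) *\<^sub>C metric ** G = mat (1/2)"
    by (simp add: cscale_mult_left metric_inverse) (simp add: vec_eq_iff mat_def)
  then have "A ** G ** A = (1/2) *\<^sub>C metric" if "A ** G ** (A ** G) = mat (1/2)" for A
    using that by (metis G_cancel matrix_mul_assoc)
  then show "U i ** G ** U i = (1/2) *\<^sub>C metric" "V i ** G ** V i = (1/2) *\<^sub>C metric"
    using clifford_square[OF u_clifford] clifford_square[OF v_clifford] by blast+
qed

lemma weyl_trace:
  "(\<Sum>i\<in>UNIV. U i ** G ** weyl_coeff i) + (\<Sum>i\<in>UNIV. V i ** G ** cnj_tensor (weyl_coeff i)) = 0"
proof -
  \<comment> \<open>Contracting the first indices of both factors through \<open>G\<close> is a
    matrix product with the transpose; antisymmetry later replaces the transpose by an overall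
    sign.\<close>
  have t: "(transpose A ** G ** B) $ \<beta> $ \<nu> = (\<Sum>\<alpha>\<in>UNIV. \<Sum>\<mu>\<in>UNIV. G $ \<alpha> $ \<mu> * (A $ \<alpha> $ \<beta> * B $ \<mu> $ \<nu>))" for A B \<beta> \<nu>
    unfolding matrix_matrix_mult_def transpose_def
    by (simp add: sum_distrib_right sum_distrib_left mult_ac) (rule sum.swap)
  have "(\<Sum>\<alpha>\<in>UNIV. \<Sum>\<mu>\<in>UNIV. G $ \<alpha> $ \<mu> * slice \<mu> \<nu> $ \<alpha> $ \<beta>) = 0" for \<beta> \<nu>
  proof -
    have "(\<Sum>\<alpha>\<in>UNIV. \<Sum>\<mu>\<in>UNIV. G $ \<alpha> $ \<mu> * slice \<mu> \<nu> $ \<alpha> $ \<beta>) =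
        complex_of_real (\<Sum>\<alpha>\<in>UNIV. \<Sum>\<mu>\<in>UNIV. matrix_inv g $ \<alpha> $ \<mu> * W $ \<alpha> $ \<beta> $ \<mu> $ \<nu>)"
      by (simp add: inverse_metric_def ginv_def)
    also have "(\<Sum>\<alpha>\<in>UNIV. \<Sum>\<mu>\<in>UNIV. matrix_inv g $ \<alpha> $ \<mu> * W $ \<alpha> $ \<beta> $ \<mu> $ \<nu>) = 0"
      using weyl unfolding weyl_tensor_def by blast
    finally show ?thesis by simp
  qed
  then have "(\<Sum>\<alpha>\<in>UNIV. \<Sum>\<mu>\<in>UNIV. G $ \<alpha> $ \<mu> * ((\<Sum>i\<in>UNIV. U i $ \<alpha> $ \<beta> * weyl_coeff i $ \<mu> $ \<nu>) +
      (\<Sum>i\<in>UNIV. V i $ \<alpha> $ \<beta> * cnj_tensor (weyl_coeff i) $ \<mu> $ \<nu>))) = 0" for \<beta> \<nu>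
    unfolding slice_expansion by (simp add: mult.commute)
  then have "((\<Sum>i\<in>UNIV. transpose (U i) ** G ** weyl_coeff i) +
      (\<Sum>i\<in>UNIV. transpose (V i) ** G ** cnj_tensor (weyl_coeff i))) $ \<beta> $ \<nu> = 0" for \<beta> \<nu>
    by (simp add: t distrib_left sum.distrib sum_distrib_left
      sum.swap[of _ "UNIV :: 3 set" "UNIV :: 4 set"] del: cnj_tensor_nth)
  then have "(\<Sum>i\<in>UNIV. transpose (U i) ** G ** weyl_coeff i) +
      (\<Sum>i\<in>UNIV. transpose (V i) ** G ** cnj_tensor (weyl_coeff i)) = 0"
    by (simp only: vec_eq_iff zero_index) blast
  then have "- ((\<Sum>i\<in>UNIV. U i ** G ** weyl_coeff i) + (\<Sum>i\<in>UNIV. V i ** G ** cnj_tensor (weyl_coeff i))) = 0"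
    by (simp add: sd_transpose V_transpose matrix_mult_uminus_left sum_negf)
  then show ?thesis
    by (simp only: neg_equal_0_iff_equal)
qed

text \<open>In \<open>weyl_trace\<close> the squares contribute multiples of the metric and the
  mixed products contribute \<open>\<Pi>\<close> tensors. By hermiticity the two halves carry the
  same mixed part, so nothing cancels; orthogonality of metric and \<open>\<Pi>\<close> makes both
  parts vanish separately.\<close>

lemma mixed_zero: "mixed k l = 0" and eigenvalue_sum_imaginary: "(\<Sum>i\<in>UNIV. \<rho> i) + (\<Sum>i\<in>UNIV. cnj (\<rho> i)) = 0"
proof -
  have U_coeff: "U i ** G ** weyl_coeff i = (- \<rho> i / 2) *\<^sub>C metric + (\<Sum>j\<in>UNIV. mixed i j *\<^sub>C Pi_U i j)" for i
    by (subst weyl_coeff_eq) (simp add: matrix_add_ldistrib matrix_mult_sum_right cscale_mult_right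
        U_square Pi_eq matrix_mult_uminus_right matrix_diff_ldistrib)
  have V_coeff: "V i ** G ** cnj_tensor (weyl_coeff i) =
      (- cnj (\<rho> i) / 2) *\<^sub>C metric + (\<Sum>j\<in>UNIV. mixed j i *\<^sub>C Pi_U j i)" for i
  proof -
    have "cnj_tensor (weyl_coeff i) = (- cnj (\<rho> i)) *\<^sub>C V i + (\<Sum>j\<in>UNIV. mixed j i *\<^sub>C U j)"
      by (subst weyl_coeff_eq) (simp add: vec_eq_iff V_def cnj_mixed)
    then show ?thesis
      by (simp add: matrix_add_ldistrib matrix_mult_sum_right cscale_mult_right V_square Pi_eq'
        matrix_diff_ldistrib)
  qed
  have swap: "(\<Sum>i\<in>UNIV. \<Sum>j\<in>UNIV. mixed j i *\<^sub>C Pi_U j i) = (\<Sum>i\<in>UNIV. \<Sum>j\<in>UNIV. mixed i j *\<^sub>C Pi_U i j)"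
    by (rule sum.swap)
  define c where "c = (\<Sum>i\<in>UNIV. - \<rho> i / 2) + (\<Sum>i\<in>UNIV. - cnj (\<rho> i) / 2)"
  let ?M = "\<Sum>i\<in>UNIV. \<Sum>j\<in>UNIV. mixed i j *\<^sub>C Pi_U i j"
  have "c *\<^sub>C metric + ?M + ?M = 0"
    using weyl_trace unfolding U_coeff V_coeff sum.distrib swap c_def ctensor.scale_left_distrib
      ctensor.scale_sum_left by (simp only: add_ac)
  then have eq: "c *\<^sub>C metric + 2 *\<^sub>C ?M = 0"
    by (simp add: vec_eq_iff algebra_simps)
  have m: "inner2 g metric (Pi_U i j) = 0" for i j
    using Pi_traceless_symmetric[of i j]
    by (simp add: inner2_eq metric_inverse Pi_symmetric traceless_symmetric_iff)
  have "inner2 g (c *\<^sub>C metric + 2 *\<^sub>C ?M) (Pi_U k l) = 2 * mixed k l" for k l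
    by (simp only: inner2_add_left inner2_scale_left m inner2_Pi_combination) simp
  then show mz: "mixed k l = 0" for k l
    unfolding eq by (simp add: inner2_def)
  have "c *\<^sub>C metric = 0 *\<^sub>C metric"
    using eq by (simp add: mz)
  then have "trace (c *\<^sub>C metric ** G) = trace (0 *\<^sub>C metric ** G)" by (rule arg_cong)
  then have "c = 0"
    by (simp only: cscale_mult_left trace_cscale metric_inverse trace_mat) simp
  then show "(\<Sum>i\<in>UNIV. \<rho> i) + (\<Sum>i\<in>UNIV. cnj (\<rho> i)) = 0"
    by (simp add: c_def sum_negf flip: sum_divide_distrib)
      (simp add: add_eq_0_iff flip: add_divide_distrib)
qed

lemma sd_weyl_eq: "sd_weyl g orient W $ \<alpha> $ \<beta> $ \<mu> $ \<nu> = - (\<Sum>i\<in>UNIV. \<rho> i * U i $ \<alpha> $ \<beta> * U i $ \<mu> $ \<nu>)"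
  by (simp add: sd_weyl_slice weyl_coeff_eq mixed_zero sum_negf mult_ac)

lemma W_eq: "complex_of_real (W $ \<alpha> $ \<beta> $ \<mu> $ \<nu>) =
  - (\<Sum>i\<in>UNIV. \<rho> i * (U i $ \<alpha> $ \<beta> * U i $ \<mu> $ \<nu>)) - (\<Sum>i\<in>UNIV. cnj (\<rho> i) * (V i $ \<alpha> $ \<beta> * V i $ \<mu> $ \<nu>))"
proof -
  have "slice \<mu> \<nu> $ \<alpha> $ \<beta> = (\<Sum>i\<in>UNIV. weyl_coeff i $ \<mu> $ \<nu> * U i $ \<alpha> $ \<beta>) +
      (\<Sum>i\<in>UNIV. cnj (weyl_coeff i $ \<mu> $ \<nu>) * V i $ \<alpha> $ \<beta>)"
    by (subst slice_expansion) simp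
  then show ?thesis
    by (simp add: weyl_coeff_eq mixed_zero V_def sum_negf mult_ac)
qed

section \<open>The first Bianchi identity\<close>

text \<open>The cyclic sum of the first Bianchi identity for the tensor square of \<open>A\<close>,
  evaluated on \<open>U k\<close> twice. By \<open>W_eq\<close>, \<open>W\<close> is a linear
  combination of such squares.\<close>

definition bianchi_form :: "3 \<Rightarrow> tensor2 \<Rightarrow> complex" where
  "bianchi_form k A = (\<Sum>\<alpha>\<in>UNIV. \<Sum>\<beta>\<in>UNIV. \<Sum>\<mu>\<in>UNIV. \<Sum>\<nu>\<in>UNIV.
    (A $ \<alpha> $ \<beta> * A $ \<mu> $ \<nu> + A $ \<alpha> $ \<mu> * A $ \<nu> $ \<beta> + A $ \<alpha> $ \<nu> * A $ \<beta> $ \<mu>) *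
    (raise g (U k) $ \<alpha> $ \<beta> * raise g (U k) $ \<mu> $ \<nu>))"

text \<open>The first summand factors into a square. Each of the other two is a trace of four
  antisymmetric factors with an odd number of transpositions, hence minus the same trace.\<close>

lemma bianchi_form_eq:
  assumes A: "transpose A = - A"
  shows "bianchi_form k A = (inner2 g A (U k))\<^sup>2 - 2 * trace (A ** G ** (U k ** G) ** (A ** G) ** (U k ** G))"
proof -
  let ?F = "raise g (U k)"
  have F: "transpose ?F = - ?F" "?F = G ** U k ** G"
    by (simp_all add: raise_eq matrix_transpose_mul sd_transpose matrix_mult_uminus_left
        matrix_mult_uminus_right matrix_mul_assoc)
  have 1: "(\<Sum>\<alpha>\<in>UNIV. \<Sum>\<beta>\<in>UNIV. \<Sum>\<mu>\<in>UNIV. \<Sum>\<nu>\<in>UNIV. A $ \<alpha> $ \<beta> * A $ \<mu> $ \<nu> * (?F $ \<alpha> $ \<beta> * ?F $ \<mu> $ \<nu>)) =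
      (inner2 g A (U k))\<^sup>2"
    by (simp only: inner2_def power2_eq_square sum_distrib_right, simp only: sum_distrib_left,
      simp only: mult_ac)
  have 2: "(\<Sum>\<alpha>\<in>UNIV. \<Sum>\<beta>\<in>UNIV. \<Sum>\<mu>\<in>UNIV. \<Sum>\<nu>\<in>UNIV. A $ \<alpha> $ \<mu> * A $ \<nu> $ \<beta> * (?F $ \<alpha> $ \<beta> * ?F $ \<mu> $ \<nu>)) =
      trace (A ** ?F ** A ** transpose ?F)"
  proof -
    have "(A ** ?F ** A) $ \<alpha> $ \<beta> = (\<Sum>\<mu>\<in>UNIV. \<Sum>\<nu>\<in>UNIV. A $ \<alpha> $ \<mu> * ?F $ \<mu> $ \<nu> * A $ \<nu> $ \<beta>)" for \<alpha> \<beta>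
      by (simp add: matrix_matrix_mult_def sum_distrib_right) (rule sum.swap)
    then have "trace (A ** ?F ** A ** transpose ?F) = (\<Sum>\<alpha>\<in>UNIV. \<Sum>\<beta>\<in>UNIV.
        (\<Sum>\<mu>\<in>UNIV. \<Sum>\<nu>\<in>UNIV. A $ \<alpha> $ \<mu> * ?F $ \<mu> $ \<nu> * A $ \<nu> $ \<beta>) * ?F $ \<alpha> $ \<beta>)"
      by (simp only: trace_mult_transpose)
    then show ?thesis by (simp only: sum_distrib_right) (simp only: mult_ac)
  qed
  have 3: "(\<Sum>\<alpha>\<in>UNIV. \<Sum>\<beta>\<in>UNIV. \<Sum>\<mu>\<in>UNIV. \<Sum>\<nu>\<in>UNIV. A $ \<alpha> $ \<nu> * A $ \<beta> $ \<mu> * (?F $ \<alpha> $ \<beta> * ?F $ \<mu> $ \<nu>)) =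
      trace (A ** transpose ?F ** transpose A ** transpose ?F)"
    unfolding trace_mult_transpose
    by (simp add: matrix_matrix_mult_def transpose_def sum_distrib_left sum_distrib_right mult_ac)
  have "bianchi_form k A = (inner2 g A (U k))\<^sup>2 + trace (A ** ?F ** A ** transpose ?F) +
      trace (A ** transpose ?F ** transpose A ** transpose ?F)"
    unfolding bianchi_form_def 1[symmetric] 2[symmetric] 3[symmetric]
    by (simp only: distrib_right sum.distrib)
  also have "\<dots> = (inner2 g A (U k))\<^sup>2 - 2 * trace (A ** ?F ** A ** ?F)"
    unfolding F(1) A by (simp add: matrix_mult_uminus_left matrix_mult_uminus_right trace_uminus)
  finally show ?thesis by (simp add: F(2) matrix_mul_assoc)
qed

text \<open>The value is 4 - 2 for \<open>i = k\<close> and 0 + 2 otherwise, by the sandwich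
  relation.\<close>

lemma bianchi_form_U: "bianchi_form k (U i) = 2"
proof -
  have "trace (U i ** G ** (U k ** G) ** (U i ** G) ** (U k ** G)) = (if k = i then 1 else - 1)"
    using clifford_sandwich[OF u_clifford, of i k] clifford_square[OF u_clifford, of k]
    by (simp add: cscale_mult_left trace_cscale trace_mat trace_uminus matrix_mult_uminus_left)
  then show ?thesis
    by (auto simp: bianchi_form_eq[OF sd_transpose] inner2_U_U)
qed

text \<open>Here all factors commute past each other, so the trace is 1/2 * 1/2 * 4 = 1 and the
  inner product is zero.\<close>

lemma bianchi_form_V: "bianchi_form k (V i) = - 2"
proof -
  have rearrange: "a ** u ** a ** u = a ** a ** (u ** u)" if "u ** a = a ** u" for a u :: tensor2
    using that by (metis matrix_mul_assoc)
  have "V i ** G ** (U k ** G) ** (V i ** G) ** (U k ** G) = V i ** G ** (V i ** G) ** (U k ** G ** (U k ** G))"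
    by (rule rearrange) (rule u_v_commute)
  also have "trace \<dots> = 1"
    by (simp only: clifford_square[OF u_clifford] clifford_square[OF v_clifford] mat_mult trace_cscale trace_mat) simp
  finally show ?thesis
    by (simp add: bianchi_form_eq[OF V_transpose] inner2_U_V)
qed

text \<open>Evaluated on \<open>U 1\<close>, each self-dual square contributes 2 and each
  anti-self-dual one -2, so the Bianchi identity equates the sum with its conjugate. As the sum is
  also purely imaginary, it is zero.\<close>

lemma eigenvalue_sum: "(\<Sum>i\<in>UNIV. \<rho> i) = 0"
proof -
  let ?F = "raise g (U 1)"
  have "0 = (\<Sum>\<alpha>\<in>UNIV. \<Sum>\<beta>\<in>UNIV. \<Sum>\<mu>\<in>UNIV. \<Sum>\<nu>\<in>UNIV.
      complex_of_real (W $ \<alpha> $ \<beta> $ \<mu> $ \<nu> + W $ \<alpha> $ \<mu> $ \<nu> $ \<beta> + W $ \<alpha> $ \<nu> $ \<beta> $ \<mu>) * (?F $ \<alpha> $ \<beta> * ?F $ \<mu> $ \<nu>))"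
    by (simp only: W_symmetries(4)) simp
  also have "\<dots> = (\<Sum>\<alpha>\<in>UNIV. \<Sum>\<beta>\<in>UNIV. \<Sum>\<mu>\<in>UNIV. \<Sum>\<nu>\<in>UNIV.
      - (\<Sum>i\<in>UNIV. \<rho> i * ((U i $ \<alpha> $ \<beta> * U i $ \<mu> $ \<nu> + U i $ \<alpha> $ \<mu> * U i $ \<nu> $ \<beta> + U i $ \<alpha> $ \<nu> * U i $ \<beta> $ \<mu>) *
        (?F $ \<alpha> $ \<beta> * ?F $ \<mu> $ \<nu>)))
      - (\<Sum>i\<in>UNIV. cnj (\<rho> i) * ((V i $ \<alpha> $ \<beta> * V i $ \<mu> $ \<nu> + V i $ \<alpha> $ \<mu> * V i $ \<nu> $ \<beta> + V i $ \<alpha> $ \<nu> * V i $ \<beta> $ \<mu>) *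
        (?F $ \<alpha> $ \<beta> * ?F $ \<mu> $ \<nu>))))"
    by (intro sum.cong refl)
      (simp add: W_eq sum_distrib_right sum_distrib_left distrib_left distrib_right sum.distrib
        left_diff_distrib algebra_simps)
  also have "\<dots> = - (\<Sum>i\<in>UNIV. \<rho> i * bianchi_form 1 (U i)) - (\<Sum>i\<in>UNIV. cnj (\<rho> i) * bianchi_form 1 (V i))"
    unfolding bianchi_form_def
    by (simp only: sum_distrib_left sum_subtractf sum_negf sum.swap[of _ "UNIV :: 3 set" "UNIV :: 4 set"])
  also have "\<dots> = 2 * (\<Sum>i\<in>UNIV. cnj (\<rho> i)) - 2 * (\<Sum>i\<in>UNIV. \<rho> i)"
    by (simp add: bianchi_form_U bianchi_form_V sum_negf mult.commute[of _ 2] flip: sum_distrib_left)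
  finally show ?thesis
    using eigenvalue_sum_imaginary by (simp add: algebra_simps)
qed

section \<open>Invariants in terms of the eigenvalues\<close>

text \<open>The minus sign compensates the norm -1 of the \<open>U i\<close>, so that the
  \<open>x i\<close> are the eigenvalues of \<open>bivector_map g S\<close>.\<close>

definition diagonal_sd :: "tensor4 \<Rightarrow> (3 \<Rightarrow> complex) \<Rightarrow> bool" where
  "diagonal_sd S x \<longleftrightarrow> (\<forall>\<alpha> \<beta> \<mu> \<nu>. S $ \<alpha> $ \<beta> $ \<mu> $ \<nu> = - (\<Sum>i\<in>UNIV. x i * U i $ \<alpha> $ \<beta> * U i $ \<mu> $ \<nu>))"

lemma bivector_comp_diagonal:
  assumes "diagonal_sd R x" "diagonal_sd S y"
  shows "diagonal_sd (bivector_comp g R S) (\<lambda>i. x i * y i)"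
  unfolding diagonal_sd_def
proof (intro allI)
  fix \<alpha> \<beta> \<mu> \<nu>
  define A :: tensor2 where "A = (\<chi> \<rho> \<sigma>. S $ \<rho> $ \<sigma> $ \<mu> $ \<nu>)"
  have "A = (\<Sum>i\<in>UNIV. (- y i * U i $ \<mu> $ \<nu>) *\<^sub>C U i)"
    using assms(2) by (simp add: vec_eq_iff A_def diagonal_sd_def sum_negf mult_ac)
  then have A: "inner2 g (U i) A = 2 * y i * U i $ \<mu> $ \<nu>" for i
    by (subst inner2_commute)
      (simp add: inner2_sum_left inner2_scale_left inner2_uminus_left inner2_U_U if_distrib cong: if_cong)
  have "bivector_comp g R S $ \<alpha> $ \<beta> $ \<mu> $ \<nu> = 1/2 * contract g R A $ \<alpha> $ \<beta>"
    by (simp add: bivector_comp_def bivector_map_def A_def)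
  also have "contract g R A $ \<alpha> $ \<beta> =
      - (\<Sum>i\<in>UNIV. \<Sum>\<mu>\<in>UNIV. \<Sum>\<nu>\<in>UNIV. x i * U i $ \<alpha> $ \<beta> * (U i $ \<mu> $ \<nu> * raise g A $ \<mu> $ \<nu>))"
    using assms(1) by (simp add: contract_def diagonal_sd_def sum_distrib_right mult.assoc sum_negf
        sum.swap[of _ "UNIV :: 3 set" "UNIV :: 4 set"])
  also have "\<dots> = - (\<Sum>i\<in>UNIV. x i * U i $ \<alpha> $ \<beta> * inner2 g (U i) A)"
    by (simp add: inner2_def sum_distrib_left)
  also have "1/2 * \<dots> = - (\<Sum>i\<in>UNIV. x i * y i * U i $ \<alpha> $ \<beta> * U i $ \<mu> $ \<nu>)"
    by (simp add: A sum_distrib_left mult_ac)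
  finally show "bivector_comp g R S $ \<alpha> $ \<beta> $ \<mu> $ \<nu> = - (\<Sum>i\<in>UNIV. x i * y i * U i $ \<alpha> $ \<beta> * U i $ \<mu> $ \<nu>)" .
qed

lemma bivector_trace_diagonal:
  assumes "diagonal_sd S x"
  shows "bivector_trace g S = (\<Sum>i\<in>UNIV. x i)"
proof -
  have "bivector_trace g S = 1/2 * - (\<Sum>i\<in>UNIV. \<Sum>\<alpha>\<in>UNIV. \<Sum>\<beta>\<in>UNIV. \<Sum>\<mu>\<in>UNIV. \<Sum>\<nu>\<in>UNIV.
      x i * (U i $ \<alpha> $ \<beta> * (ginv g \<alpha> \<mu> * ginv g \<beta> \<nu> * U i $ \<mu> $ \<nu>)))"
    using assms by (simp add: bivector_trace_def diagonal_sd_def sum_distrib_left sum_negf mult_ac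
        sum.swap[of _ "UNIV :: 3 set" "UNIV :: 4 set"])
  also have "\<dots> = 1/2 * - (\<Sum>i\<in>UNIV. x i * inner2 g (U i) (U i))"
    by (simp add: inner2_def raise_def sum_distrib_left)
  finally show ?thesis by (simp add: inner2_U_U sum_negf flip: sum_distrib_right)
qed

lemma sd_weyl_diagonal: "diagonal_sd (sd_weyl g orient W) \<rho>"
  by (simp add: diagonal_sd_def sd_weyl_eq)

text \<open>This links the hypothesis of type \<open>I\<^sub>r\<close>, stated through invariants,
  to the given eigenvalues.\<close>

lemma weyl_a_eq: "weyl_a g orient W = (\<Sum>i\<in>UNIV. \<rho> i ^ 2)"
  and weyl_b_eq: "weyl_b g orient W = (\<Sum>i\<in>UNIV. \<rho> i ^ 3)"
proof -
  note comp = bivector_comp_diagonal[OF sd_weyl_diagonal]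
  show "weyl_a g orient W = (\<Sum>i\<in>UNIV. \<rho> i ^ 2)"
    using bivector_trace_diagonal[OF comp[OF sd_weyl_diagonal]]
    by (simp add: weyl_a_def power2_eq_square)
  show "weyl_b g orient W = (\<Sum>i\<in>UNIV. \<rho> i ^ 3)"
    using bivector_trace_diagonal[OF comp[OF comp[OF sd_weyl_diagonal]]]
    by (simp add: weyl_b_def power3_eq_cube mult.assoc)
qed

text \<open>The product of the two diagonal forms is a double sum, and each of the two contractions
  of \<open>U i\<close> with the conjugate \<open>V j\<close> yields one factor
  \<open>Pi_U i j\<close>.\<close>

lemma bel_robinson_diagonal: "Pi_diagonal (bel_robinson g orient W) (\<lambda>i j. \<rho> i * cnj (\<rho> j))"
  unfolding Pi_diagonal_def
proof (intro allI)
  fix \<alpha> \<mu> \<beta> \<nu>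
  \<comment> \<open>The sign arises because the contraction uses the second index of
    \<open>V j\<close>; it cancels between the two \<open>\<Pi>\<close> factors.\<close>
  have Pi_nth: "Pi_U i j $ \<alpha> $ \<mu> = - (\<Sum>\<gamma>\<in>UNIV. \<Sum>\<gamma>'\<in>UNIV. ginv g \<gamma> \<gamma>' * (U i $ \<alpha> $ \<gamma>' * V j $ \<mu> $ \<gamma>))" for i j \<alpha> \<mu>
  proof -
    have "Pi_U i j = - (U i ** transpose G ** transpose (V j))"
      by (simp add: Pi_eq V_transpose matrix_mult_uminus_right)
    then show ?thesis
      by (simp add: matrix_matrix_mult_def transpose_def ginv_nth sum_distrib_left sum_distrib_right mult_ac)
  qed
  have "bel_robinson g orient W $ \<alpha> $ \<mu> $ \<beta> $ \<nu> =
    (\<Sum>\<gamma>\<in>UNIV. \<Sum>\<gamma>'\<in>UNIV. \<Sum>\<sigma>\<in>UNIV. \<Sum>\<sigma>'\<in>UNIV. ginv g \<gamma> \<gamma>' * ginv g \<sigma> \<sigma>' *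
      (sd_weyl g orient W $ \<alpha> $ \<gamma>' $ \<beta> $ \<sigma>' * cnj (sd_weyl g orient W $ \<mu> $ \<gamma> $ \<nu> $ \<sigma>)))"
    by (simp add: bel_robinson_def Let_def mult.assoc)
  also have "\<dots> = (\<Sum>\<gamma>\<in>UNIV. \<Sum>\<gamma>'\<in>UNIV. \<Sum>\<sigma>\<in>UNIV. \<Sum>\<sigma>'\<in>UNIV. \<Sum>i\<in>UNIV. \<Sum>j\<in>UNIV.
      \<rho> i * cnj (\<rho> j) * ((ginv g \<gamma> \<gamma>' * (U i $ \<alpha> $ \<gamma>' * V j $ \<mu> $ \<gamma>)) * (ginv g \<sigma> \<sigma>' * (U i $ \<beta> $ \<sigma>' * V j $ \<nu> $ \<sigma>))))"
    by (intro sum.cong refl) (simp add: sd_weyl_eq V_def sum_product, simp add: sum_distrib_left mult_ac)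
  also have "\<dots> = (\<Sum>i\<in>UNIV. \<Sum>j\<in>UNIV. \<Sum>\<gamma>\<in>UNIV. \<Sum>\<gamma>'\<in>UNIV. \<Sum>\<sigma>\<in>UNIV. \<Sum>\<sigma>'\<in>UNIV.
      \<rho> i * cnj (\<rho> j) * ((ginv g \<gamma> \<gamma>' * (U i $ \<alpha> $ \<gamma>' * V j $ \<mu> $ \<gamma>)) * (ginv g \<sigma> \<sigma>' * (U i $ \<beta> $ \<sigma>' * V j $ \<nu> $ \<sigma>))))"
    by (simp only: sum.swap[of _ "UNIV :: 3 set" "UNIV :: 4 set"])
  also have "\<dots> = (\<Sum>i\<in>UNIV. \<Sum>j\<in>UNIV. \<rho> i * cnj (\<rho> j) * (Pi_U i j $ \<alpha> $ \<mu> * Pi_U i j $ \<beta> $ \<nu>))"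
    unfolding Pi_nth minus_mult_minus
    by (simp only: sum_distrib_right, simp only: sum_distrib_left)
  finally show "bel_robinson g orient W $ \<alpha> $ \<mu> $ \<beta> $ \<nu> =
      (\<Sum>i\<in>UNIV. \<Sum>j\<in>UNIV. \<rho> i * cnj (\<rho> j) * Pi_U i j $ \<alpha> $ \<mu> * Pi_U i j $ \<beta> $ \<nu>)"
    by (simp add: mult.assoc)
qed

end

section \<open>Distinctness of the eigenvalues\<close>

text \<open>In both cases conjugation maps \<open>{x, y, z}\<close> onto \<open>{k x, k y, k z}\<close> for some \<open>k\<close>.\<close>

lemma invariant_ratio_real:
  fixes x y z :: complex
  assumes sum: "x + y + z = 0" and b: "x ^ 3 + y ^ 3 + z ^ 3 \<noteq> 0"
    and xy: "cmod x = cmod y \<or> x * cnj y \<in> \<real>"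
  shows "(x\<^sup>2 + y\<^sup>2 + z\<^sup>2) ^ 3 / (x ^ 3 + y ^ 3 + z ^ 3) ^ 2 - 6 \<in> \<real>"
proof -
  have z: "z = - x - y" using sum by (simp add: eq_neg_iff_add_eq_0 add_ac algebra_simps)
  have "\<exists>k. cnj x = k * x \<and> cnj y = k * y \<or> cnj x = k * y \<and> cnj y = k * x"
  proof (cases "y = 0")
    case True
    \<comment> \<open>For \<open>y = 0\<close> one has \<open>z = - x\<close>, and the sum of cubes
      would vanish.\<close>
    then show ?thesis using b z by (simp add: power3_eq_cube)
  next
    case False
    from xy show ?thesis
    proof
      assume "cmod x = cmod y"
      then have "x * cnj x = y * cnj y" by (metis complex_norm_square)
      then show ?thesis
        using False by (intro exI[of _ "cnj x / y"] disjI2) (simp add: field_simps)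
    next
      assume "x * cnj y \<in> \<real>"
      then have "cnj x * y = x * cnj y" by (simp add: Reals_cnj_iff)
      then show ?thesis
        using False by (intro exI[of _ "cnj y / y"] disjI1) (simp add: field_simps)
    qed
  qed
  then obtain k where k: "cnj x = k * x \<and> cnj y = k * y \<or> cnj x = k * y \<and> cnj y = k * x" by blast
  let ?a = "x\<^sup>2 + y\<^sup>2 + z\<^sup>2" and ?b = "x ^ 3 + y ^ 3 + z ^ 3"
  \<comment> \<open>Both sums are symmetric and homogeneous, of degrees 2 and 3, and
    \<open>cnj z = k * z\<close> in either case. The power of \<open>k\<close> is therefore 6 in
    both numerator and denominator of the ratio.\<close>
  have a: "cnj ?a = k ^ 2 * ?a" and b': "cnj ?b = k ^ 3 * ?b"
    using k unfolding z by (auto simp: algebra_simps power2_eq_square power3_eq_cube)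
  have "k \<noteq> 0" using b b' by (metis complex_cnj_zero_iff mult_zero_left power_zero_numeral)
  have "cnj (?a ^ 3 / ?b ^ 2) = (k ^ 2 * ?a) ^ 3 / (k ^ 3 * ?b) ^ 2"
    using a b' by (simp only: complex_cnj_divide complex_cnj_power)
  also have "\<dots> = (k ^ 6 * ?a ^ 3) / (k ^ 6 * ?b ^ 2)"
    by (simp add: power_mult_distrib flip: power_mult)
  also have "\<dots> = ?a ^ 3 / ?b ^ 2"
    using \<open>k \<noteq> 0\<close> by simp
  finally show ?thesis by (intro Reals_diff) (simp_all add: Reals_cnj_iff)
qed

text \<open>The quantifier over \<open>f\<close> stands inside so that one third index serves the
  sums of all powers of the eigenvalues.\<close>

lemma sum_3_distinct: "\<exists>k. \<forall>f :: 3 \<Rightarrow> complex. (\<Sum>x\<in>UNIV. f x) = f i + f j + f k"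
  if "i \<noteq> j" for i j
proof -
  have "\<forall>f :: 3 \<Rightarrow> complex. (\<Sum>x\<in>UNIV. f x) = f i + f j + f k" if "(i, j, k) \<in>
      {(1, 2, 3), (2, 1, 3), (1, 3, 2), (3, 1, 2), (2, 3, 1), (3, 2, 1)}" for k
    using that by (auto simp: sum_3 add_ac)
  then show ?thesis
    using \<open>i \<noteq> j\<close> exhaust_3[of i] exhaust_3[of j] by blast
qed

text \<open>A diagonal product is real, which separates it from the off-diagonal ones, and its
  modulus separates it from the other diagonal ones. Off-diagonal products sharing a factor in the
  same position differ because the \<open>r i\<close> are nonzero and distinct.\<close>

lemma inj_conjugate_products:
  fixes r :: "3 \<Rightarrow> complex"
  assumes norm: "\<And>i j. i \<noteq> j \<Longrightarrow> cmod (r i) \<noteq> cmod (r j)"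
    and nonreal: "\<And>i j. i \<noteq> j \<Longrightarrow> r i * cnj (r j) \<notin> \<real>"
  shows "inj (\<lambda>(i, j). r i * cnj (r j))"
proof (rule injI, clarify)
  fix i j k l assume eq: "r i * cnj (r j) = r k * cnj (r l)"
  have nz: "r i \<noteq> 0" for i
  proof
    assume "r i = 0"
    moreover have "i + 1 \<noteq> i" by simp
    ultimately show False using nonreal[of "i + 1" i] by simp
  qed
  have sq: "r i * cnj (r i) \<in> \<real>" for i
    by (simp flip: complex_norm_square)
  have neq: "r i \<noteq> r j" if "i \<noteq> j" for i j
    using norm[OF that] by metis
  have cm: "cmod (r i) * cmod (r j) = cmod (r k) * cmod (r l)"
    using arg_cong[OF eq, of cmod] by (simp add: norm_mult)
  have third: "a = b \<or> a = c \<or> b = c \<or> d = a \<or> d = b \<or> d = c" for a b c d :: 3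
    using exhaust_3[of a] exhaust_3[of b] exhaust_3[of c] exhaust_3[of d] by auto
  consider "i = j" | "i \<noteq> j" "i = k" | "i \<noteq> j" "j = l" | "i \<noteq> j" "i \<noteq> k" "j \<noteq> l"
    by blast
  then show "i = k \<and> j = l"
  proof cases
    case 1
    then have "k = l" using eq sq[of i] nonreal[of k l] by metis
    with 1 have "(cmod (r i))\<^sup>2 = (cmod (r k))\<^sup>2"
      using cm by (simp add: power2_eq_square)
    then have "i = k" using norm[of i k] by (auto simp: power2_eq_iff_nonneg)
    with 1 \<open>k = l\<close> show ?thesis by simp
  next
    case 2
    then show ?thesis using eq nz[of k] neq[of j l] by auto
  next
    case 3
    then show ?thesis using eq nz[of l] neq[of i k] by auto
  next
    case 4
    have "k \<noteq> l" using eq 4 sq[of k] nonreal[of i j] by metis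
    show ?thesis
    \<comment> \<open>With only three indices, the pairs must now share an index crosswise.
      Cancelling its modulus either swaps the pair completely, so the product equals its own
      conjugate, or equates two distinct moduli.\<close>
    proof (cases "j = k")
      case True
      then have "cmod (r i) = cmod (r l)"
        using cm nz[of k] by (simp add: mult.commute)
      then have "i = l" using norm[of i l] by blast
      then have "cnj (r i * cnj (r j)) = r i * cnj (r j)"
        using eq True \<open>i = l\<close> by (simp add: mult.commute)
      then show ?thesis using 4 nonreal[of i j] by (simp add: Reals_cnj_iff)
    next
      case False
      then have "l = i" using third[of i j k l] 4 \<open>k \<noteq> l\<close> by auto
      then have "cmod (r j) = cmod (r k)"
        using cm nz[of i] by (simp add: mult.commute)
      then show ?thesis using norm[OF False] by blast
    qed
  qed
qed

lemma numeral_mod_3: "(4 :: 3) = 1" "(5 :: 3) = 2"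
  by simp_all

lemma distinct_eigenvalues:
  assumes "inj (\<lambda>(i, j). r i * cnj (r j))"
  shows "distinct [t_val r 1, t_val r 2, t_val r 3, tau_val r 1, tau_val r 2, tau_val r 3,
    cnj (tau_val r 1), cnj (tau_val r 2), cnj (tau_val r 3)]"
proof -
  \<comment> \<open>The index pairs follow the order of the claimed list: (i, i), then (i + 1, i +
    2), then (i + 2, i + 1), modulo 3.\<close>
  let ?l = "[(1, 1), (2, 2), (3, 3), (2, 3), (3, 1), (1, 2), (3, 2), (1, 3), (2, 1)] :: (3 \<times> 3) list"
  have "distinct ?l" by simp
  moreover have "inj_on (\<lambda>(i, j). r i * cnj (r j)) (set ?l)"
    using assms inj_on_subset by blast
  ultimately have "distinct (map (\<lambda>(i, j). r i * cnj (r j)) ?l)"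
    unfolding distinct_map by blast
  moreover have "t_val r i = r i * cnj (r i)" for i
    by (simp only: t_val_def complex_norm_square)
  then have "map (\<lambda>(i, j). r i * cnj (r j)) ?l = [t_val r 1, t_val r 2, t_val r 3,
      tau_val r 1, tau_val r 2, tau_val r 3, cnj (tau_val r 1), cnj (tau_val r 2), cnj (tau_val r 3)]"
    by (simp add: tau_val_def mult.commute numeral_mod_3)
  ultimately show ?thesis by metis
qed

theorem proposition4:
  fixes g :: "real^4^4" and orient :: real and W :: "real^4^4^4^4"
    and \<rho> :: "3 \<Rightarrow> complex" and U :: "3 \<Rightarrow> tensor2"
  assumes "lorentzian g"
    and "orient = 1 \<or> orient = - 1"
    and "weyl_tensor g W"
    and "type_Ir g orient W"
    and "orthonormal_sd_frame g orient U"
    and "\<And>i. bivector_map g (sd_weyl g orient W) (U i) = \<rho> i *\<^sub>C U i"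
  shows
    "(\<forall>\<alpha> \<beta> \<mu> \<nu>. sd_weyl g orient W $ \<alpha> $ \<beta> $ \<mu> $ \<nu> =
        - (\<Sum>i\<in>UNIV. \<rho> i * U i $ \<alpha> $ \<beta> * U i $ \<mu> $ \<nu>))
     \<and> (\<forall>\<alpha> \<beta> \<mu> \<nu>. bel_robinson g orient W $ \<alpha> $ \<beta> $ \<mu> $ \<nu> =
        (\<Sum>i\<in>UNIV. t_val \<rho> i * Pi_tensor g U i i $ \<alpha> $ \<beta> * Pi_tensor g U i i $ \<mu> $ \<nu>)
      + (\<Sum>i\<in>UNIV. tau_val \<rho> i *
           Pi_tensor g U (i + 1) (i + 2) $ \<alpha> $ \<beta> * Pi_tensor g U (i + 1) (i + 2) $ \<mu> $ \<nu>)
      + (\<Sum>i\<in>UNIV. cnj (tau_val \<rho> i) *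
           Pi_tensor g U (i + 2) (i + 1) $ \<alpha> $ \<beta> * Pi_tensor g U (i + 2) (i + 1) $ \<mu> $ \<nu>))
     \<and> (\<forall>i. eigentensor g (bel_robinson g orient W) (t_val \<rho> i) (Pi_tensor g U i i)
           \<and> eigentensor g (bel_robinson g orient W) (tau_val \<rho> i) (Pi_tensor g U (i + 1) (i + 2))
           \<and> eigentensor g (bel_robinson g orient W) (cnj (tau_val \<rho> i)) (Pi_tensor g U (i + 2) (i + 1)))
     \<and> (distinct [t_val \<rho> 1, t_val \<rho> 2, t_val \<rho> 3,
                   tau_val \<rho> 1, tau_val \<rho> 2, tau_val \<rho> 3,
                   cnj (tau_val \<rho> 1), cnj (tau_val \<rho> 2), cnj (tau_val \<rho> 3)])
     \<and> (normalized_eigenframe g (bel_robinson g orient W) (\<lambda>(i, j). Pi_tensor g U i j))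
     \<and> (\<forall>B :: 3 \<times> 3 \<Rightarrow> tensor2. normalized_eigenframe g (bel_robinson g orient W) B \<longrightarrow>
           (\<exists>(p :: 3 \<times> 3 \<Rightarrow> 3 \<times> 3) (s :: 3 \<times> 3 \<Rightarrow> complex). bij p \<and> (\<forall>n. s n = 1 \<or> s n = - 1) \<and>
              (\<forall>n. B n = s n *\<^sub>C Pi_tensor g U (fst (p n)) (snd (p n)))))"
proof -
  interpret weyl_frame g orient U W \<rho>
    using assms by unfold_locales
  note T = bel_robinson_diagonal
  have b: "weyl_b g orient W \<noteq> 0" and M: "weyl_M g orient W \<notin> \<real>"
    using assms(4) by (simp_all add: type_Ir_def)
  \<comment> \<open>Contrapositive of \<open>invariant_ratio_real\<close>, applied with the
    remaining index \<open>k\<close> as third root.\<close>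
  have generic: "cmod (\<rho> i) \<noteq> cmod (\<rho> j)" "\<rho> i * cnj (\<rho> j) \<notin> \<real>" if ij: "i \<noteq> j" for i j
  proof -
    obtain k where k: "\<And>f :: 3 \<Rightarrow> complex. (\<Sum>x\<in>UNIV. f x) = f i + f j + f k"
      using sum_3_distinct[OF ij] by blast
    show "cmod (\<rho> i) \<noteq> cmod (\<rho> j)" "\<rho> i * cnj (\<rho> j) \<notin> \<real>"
      using invariant_ratio_real[of "\<rho> i" "\<rho> j" "\<rho> k"] b M
      unfolding weyl_M_def weyl_a_eq weyl_b_eq k by (metis eigenvalue_sum k)+
  qed
  have inj: "inj (\<lambda>(i, j). \<rho> i * cnj (\<rho> j))"
    using generic by (rule inj_conjugate_products)
  have t: "t_val \<rho> i = \<rho> i * cnj (\<rho> i)" for i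
    by (simp only: t_val_def complex_norm_square)
  have tau: "tau_val \<rho> i = \<rho> (i + 1) * cnj (\<rho> (i + 2))"
    and cnj_tau: "cnj (tau_val \<rho> i) = \<rho> (i + 2) * cnj (\<rho> (i + 1))" for i
    by (simp_all add: tau_val_def mult.commute)
  have canonical: "bel_robinson g orient W $ \<alpha> $ \<beta> $ \<mu> $ \<nu> =
      (\<Sum>i\<in>UNIV. t_val \<rho> i * Pi_U i i $ \<alpha> $ \<beta> * Pi_U i i $ \<mu> $ \<nu>)
    + (\<Sum>i\<in>UNIV. tau_val \<rho> i * Pi_U (i + 1) (i + 2) $ \<alpha> $ \<beta> * Pi_U (i + 1) (i + 2) $ \<mu> $ \<nu>)
    + (\<Sum>i\<in>UNIV. cnj (tau_val \<rho> i) * Pi_U (i + 2) (i + 1) $ \<alpha> $ \<beta> * Pi_U (i + 2) (i + 1) $ \<mu> $ \<nu>)"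
    for \<alpha> \<beta> \<mu> \<nu>
    \<comment> \<open>The nine terms of the double sum are regrouped into the diagonal and the two
      cyclic off-diagonal triples.\<close>
    using T by (simp add: Pi_diagonal_def t tau cnj_tau sum_3 numeral_mod_3)
  have eigen_all: "eigentensor g (bel_robinson g orient W) (t_val \<rho> i) (Pi_U i i)
      \<and> eigentensor g (bel_robinson g orient W) (tau_val \<rho> i) (Pi_U (i + 1) (i + 2))
      \<and> eigentensor g (bel_robinson g orient W) (cnj (tau_val \<rho> i)) (Pi_U (i + 2) (i + 1))" for i
    \<comment> \<open>The conjugates are rewritten first, since \<open>tau\<close> would otherwise
      expand beneath \<open>cnj\<close>.\<close>
    unfolding cnj_tau unfolding t tau using Pi_eigentensor[OF T] by blast
  show ?thesis
    using sd_weyl_eq canonical eigen_all distinct_eigenvalues[OF inj] Pi_normalized_eigenframe[OF T]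
      normalized_eigenframe_unique[OF T inj] by blast
qed

end
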